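(* Let $B$ be a hyper-bouquet, i.e. a ribbon hypermap with exactly one hypervertex. Then the partial-dual polynomial ${}^{\partial}\varepsilon_{B}(z)$ has a nonzero constant term if and only if the intersection graph $I(B)$ is bipartite and $\varepsilon(e)=0$ for every hyperedge $e\in E(B)$.
   Context: A ribbon hypermap $H$ is a (possibly non-orientable) surface with boundary, written as the union of two sets of discs, the hypervertices $V(H)$ and the hyperedges $E(H)$, such that hypervertices and hyperedges meet in disjoint line segments (common line segments), each lying on the boundary of exactly one hypervertex and exactly one hyperedge. The hyperfaces of $H$ are the boundary components of this surface. $v(H),e(H),f(H),k(H)$ denote the numbers of hypervertices, hyperedges, hyperfaces and connected components. The degree $d(e)$ of a hyperedge is the number of common line segments on it, and $d(H)=\sum_{e\in E(H)}d(e)$. The Euler characteristic is $\chi(H)=v(H)+e(H)+f(H)-d(H)$ and the Euler genus is $\varepsilon(H)=2k(H)-\chi(H)$. For $A\subseteq E(H)$, $A$ also denotes the sub-ribbon hypermap obtained from $H$ by deleting all hyperedges not in $A$ but keeping all hypervertices; in particular $\varepsilon(e)$ is the Euler genus of the sub-ribbon hypermap consisting of all hypervertices and the single hyperedge $e$. Partial dual: in an arrow presentation of $H$ (hypervertices drawn as closed curves, each hyperedge $e$ represented by $d(e)$ arrows $e_1,\dots,e_{d(e)}$ on these curves, one along each of its common line segments, in the cyclic order met along the boundary of $e$), the partial dual $H^A$ for $A\subseteq E(H)$ is obtained as follows: for each $e\in A$ and each $i$, draw a new arrow from the head of $e_i$ to the tail of $e_{i+1}$ (indices mod $d(e)$),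 label it $e_i$, and delete the original arrows; the new arrows become arcs of the new closed curves forming the arrow presentation of $H^A$. (Equivalently, the hypervertices of $H^A$ correspond to the boundary components of the sub-ribbon hypermap $A$, and $H^A$ has the same hyperedges.) The partial-dual polynomial is ${}^{\partial}\varepsilon_{H}(z)=\sum_{A\subseteq E(H)} z^{\varepsilon(H^A)}$. The ribbon graph $R(H)$: replace each hyperedge $e$ by a new vertex disc $v_e$ (central vertex of $e$) and $d(e)$ ordinary edges $e_1,\dots,e_{d(e)}$, the $i$-th joining $v_e$ to the hypervertex at the $i$-th common line segment of $e$, attached around $v_e$ in the cyclic order of the common line segments along the boundary of $e$ (so that $R(H)$ is the natural ribbon graph associated with $H$). Four common line segments $cl_1,cl_2,cl_3,cl_4$ of hyperedges $e,f,g,h$ (possibly $e=g$ and/or $f=h$) alternate at a hypervertex $v$ if they occur in the cyclic order $(cl_1\cdots cl_2\cdots cl_3\cdots cl_4\cdots)$ around the boundary of $v$, and $v_e,v_g$ lie in one connected component of $R(H)\setminus v$ while $v_f,v_h$ lie in a different connected component of $R(H)\setminus v$. Intersection graph $I(B)$ of a hyper-bouquet $B$: its vertex set is $E(B)$, and $e,f$ are adjacent iff there are common line segments $e_i,e_j$ of $e$ and $f_m,f_n$ of $f$ such that $e_i,f_m,e_j,f_n$ alternate at the unique hypervertex of $B$. *)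

theory Defs
  imports "HOL-Computational_Algebra.Polynomial"
begin

text \<open>
  Ribbon hypermaps are encoded combinatorially by \<^emph>\<open>flags\<close>: a flag is an endpoint of a common line
  segment, so every common line segment \<open>c\<close> carries exactly two flags, and \<open>c\<close> is represented by the
  set of these two flags.  Three fixed-point-free involutions on flags record the boundaries
  of the discs:

  \<^item> \<open>seg\<close> exchanges the two endpoints of a common line segment;
  \<^item> \<open>varc\<close> exchanges the two endpoints of an arc of a hypervertex boundary lying between consecutive
    common line segments;
  \<^item> \<open>earc\<close> does the same for the arcs of the hyperedge boundaries.

  The boundary circle of a hypervertex (hyperedge) alternates between common line segments and arcs,
  so it is an orbit of \<open>seg\<close> and \<open>varc\<close> (of \<open>seg\<close> and \<open>earc\<close>).  No compatible orientation
  of the discs is required, so non-orientable surfaces are included.  Hypervertices and hyperedges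
  are named explicitly, because discs without common line segments carry no flags.

  In an arrow presentation the arrows \<open>e\<^sub>1, \<dots>, e\<^sub>d\<close> of a hyperedge \<open>e\<close> are its common line
  segments, directed consistently along the boundary of \<open>e\<close>; thus \<open>earc\<close> pairs the head of \<open>e\<^sub>i\<close>
  with the tail of \<open>e\<^sub>i\<^sub>+\<^sub>1\<close>.
\<close>

record ('v, 'e, 'x) rhmap =
  hverts :: "'v set"
  hedges :: "'e set"
  flags :: "'x set"
  vx :: "'x \<Rightarrow> 'v"
  ed :: "'x \<Rightarrow> 'e"
  seg :: "'x \<Rightarrow> 'x"
  varc :: "'x \<Rightarrow> 'x"
  earc :: "'x \<Rightarrow> 'x"

definition fpf_involution_on :: "'x set \<Rightarrow> ('x \<Rightarrow> 'x) \<Rightarrow> bool" where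
  "fpf_involution_on X f \<longleftrightarrow> (\<forall>x\<in>X. f x \<in> X \<and> f x \<noteq> x \<and> f (f x) = x)"

definition orbit_rel :: "'x set \<Rightarrow> ('x \<Rightarrow> 'x) \<Rightarrow> ('x \<Rightarrow> 'x) \<Rightarrow> ('x \<times> 'x) set" where
  "orbit_rel X f g = {(x, y). x \<in> X \<and> (y = f x \<or> y = g x)}\<^sup>* \<inter> X \<times> X"

locale ribbon_hypermap =
  fixes H :: "('v, 'e, 'x) rhmap"
  assumes finite_hverts: "finite (hverts H)"
    and finite_hedges: "finite (hedges H)"
    and finite_flags: "finite (flags H)"
    and vx_in: "x \<in> flags H \<Longrightarrow> vx H x \<in> hverts H"
    and ed_in: "x \<in> flags H \<Longrightarrow> ed H x \<in> hedges H"
    and seg_inv: "fpf_involution_on (flags H) (seg H)"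
    and varc_inv: "fpf_involution_on (flags H) (varc H)"
    and earc_inv: "fpf_involution_on (flags H) (earc H)"
    and hvert_circle: "x \<in> flags H \<Longrightarrow> y \<in> flags H \<Longrightarrow>
      vx H x = vx H y \<longleftrightarrow> (x, y) \<in> orbit_rel (flags H) (seg H) (varc H)"
    and hedge_circle: "x \<in> flags H \<Longrightarrow> y \<in> flags H \<Longrightarrow>
      ed H x = ed H y \<longleftrightarrow> (x, y) \<in> orbit_rel (flags H) (seg H) (earc H)"

definition hyper_bouquet :: "('v, 'e, 'x) rhmap \<Rightarrow> bool" where
  "hyper_bouquet B \<longleftrightarrow> ribbon_hypermap B \<and> card (hverts B) = 1"


definition segments :: "('v, 'e, 'x) rhmap \<Rightarrow> 'x set set" where
  "segments H = (\<lambda>x. {x, seg H x}) ` flags H"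

definition degree_hedge :: "('v, 'e, 'x) rhmap \<Rightarrow> 'e \<Rightarrow> nat" where
  "degree_hedge H e = card {c \<in> segments H. ed H ` c = {e}}"

definition degree_hmap :: "('v, 'e, 'x) rhmap \<Rightarrow> nat" where
  "degree_hmap H = (\<Sum>e\<in>hedges H. degree_hedge H e)"

text \<open>
  Boundary components follow hypervertex arcs and hyperedge arcs alternately; in addition, each disc
  meeting no other disc contributes its own boundary circle.
\<close>
definition num_hfaces :: "('v, 'e, 'x) rhmap \<Rightarrow> nat" where
  "num_hfaces H = card (flags H // orbit_rel (flags H) (varc H) (earc H))
     + card (hverts H - vx H ` flags H) + card (hedges H - ed H ` flags H)"

definition discs :: "('v, 'e, 'x) rhmap \<Rightarrow> ('v + 'e) set" where
  "discs H = Inl ` hverts H \<union> Inr ` hedges H"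

definition same_component :: "('v, 'e, 'x) rhmap \<Rightarrow> (('v + 'e) \<times> ('v + 'e)) set" where
  "same_component H =
     ((\<lambda>x. (Inl (vx H x), Inr (ed H x))) ` flags H \<union>
      (\<lambda>x. (Inr (ed H x), Inl (vx H x))) ` flags H)\<^sup>* \<inter> discs H \<times> discs H"

definition num_components :: "('v, 'e, 'x) rhmap \<Rightarrow> nat" where
  "num_components H = card (discs H // same_component H)"

definition euler_char :: "('v, 'e, 'x) rhmap \<Rightarrow> int" where
  "euler_char H = int (card (hverts H)) + int (card (hedges H)) + int (num_hfaces H)
     - int (degree_hmap H)"

definition euler_genus :: "('v, 'e, 'x) rhmap \<Rightarrow> int" where
  "euler_genus H = 2 * int (num_components H) - euler_char H"


text \<open>
  Crossing a common line segment and then following the next hypervertex arc: iterating this from a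
  flag \<open>x\<close> meets, once each, the common line segments around the hypervertex of \<open>x\<close> in cyclic order
  (for the direction of traversal determined by \<open>x\<close>).
\<close>
definition vnext :: "('v, 'e, 'x) rhmap \<Rightarrow> 'x \<Rightarrow> 'x" where
  "vnext H x = varc H (seg H x)"

text \<open>
  The sub-ribbon hypermap \<open>A\<close>.  Deleting the other hyperedges turns their common line segments into
  parts of hypervertex arcs, so the arc leaving a flag \<open>x\<close> now runs to the first flag of a surviving
  common line segment.
\<close>
definition sub_hmap :: "('v, 'e, 'x) rhmap \<Rightarrow> 'e set \<Rightarrow> ('v, 'e, 'x) rhmap" where
  "sub_hmap H A = H\<lparr>
     hedges := hedges H \<inter> A,
     flags := {x \<in> flags H. ed H x \<in> A},
     varc := (\<lambda>x. (vnext H ^^ (LEAST n. ed H ((vnext H ^^ n) (varc H x)) \<in> A)) (varc H x))\<rparr>"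

text \<open>
  The partial dual: for \<open>e \<in> A\<close> the new arrow \<open>e\<^sub>i\<close> joins the head of the old \<open>e\<^sub>i\<close> to the tail of the
  old \<open>e\<^sub>i\<^sub>+\<^sub>1\<close>, i.e. it runs along the old hyperedge arc between them.  The head of the
  new \<open>e\<^sub>i\<close> and the tail of the new \<open>e\<^sub>i\<^sub>+\<^sub>1\<close> are then the two endpoints of the old \<open>e\<^sub>i\<^sub>+\<^sub>1\<close>.  So \<open>seg\<close> and
  \<open>earc\<close> are interchanged on the flags of hyperedges in \<open>A\<close>.  The new hypervertices are the resulting
  closed curves, together with the closed curves of \<open>H\<close> without arrows.
\<close>
definition pd_seg :: "('v, 'e, 'x) rhmap \<Rightarrow> 'e set \<Rightarrow> 'x \<Rightarrow> 'x" where
  "pd_seg H A x = (if ed H x \<in> A then earc H x else seg H x)"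

definition pd_earc :: "('v, 'e, 'x) rhmap \<Rightarrow> 'e set \<Rightarrow> 'x \<Rightarrow> 'x" where
  "pd_earc H A x = (if ed H x \<in> A then seg H x else earc H x)"

definition partial_dual ::
  "('v, 'e, 'x) rhmap \<Rightarrow> 'e set \<Rightarrow> ('x set + 'v, 'e, 'x) rhmap" where
  "partial_dual H A =
     (let R = orbit_rel (flags H) (pd_seg H A) (varc H) in
      \<lparr>hverts = Inl ` (flags H // R) \<union> Inr ` (hverts H - vx H ` flags H),
       hedges = hedges H,
       flags = flags H,
       vx = (\<lambda>x. Inl (R `` {x})),
       ed = ed H,
       seg = pd_seg H A,
       varc = varc H,
       earc = pd_earc H A\<rparr>)"

text \<open>The Euler genus of a ribbon hypermap is non-negative, so \<open>nat\<close> does not truncate here.\<close>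
definition partial_dual_poly :: "('v, 'e, 'x) rhmap \<Rightarrow> int poly" where
  "partial_dual_poly H = (\<Sum>A\<in>Pow (hedges H). monom 1 (nat (euler_genus (partial_dual H A))))"


text \<open>
  The ribbon graph \<open>R(H)\<close>, as a ribbon hypermap whose hyperedges all have degree 2.  Its vertices are
  the hypervertices \<open>Inl v\<close> of \<open>H\<close> and the central vertices \<open>Inr e\<close>; there is one edge for each common
  line segment.  The flags \<open>(x, False)\<close> lie on \<open>Inl (vx H x)\<close> and the flags \<open>(x, True)\<close> on
  \<open>Inr (ed H x)\<close>.
\<close>
definition ribbon_graph ::
  "('v, 'e, 'x) rhmap \<Rightarrow> ('v + 'e, 'x set, 'x \<times> bool) rhmap" where
  "ribbon_graph H =
     \<lparr>hverts = Inl ` hverts H \<union> Inr ` hedges H,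
      hedges = segments H,
      flags = flags H \<times> UNIV,
      vx = (\<lambda>(x, b). if b then Inr (ed H x) else Inl (vx H x)),
      ed = (\<lambda>(x, b). {x, seg H x}),
      seg = (\<lambda>(x, b). (seg H x, b)),
      varc = (\<lambda>(x, b). (if b then earc H x else varc H x, b)),
      earc = (\<lambda>(x, b). (x, \<not> b))\<rparr>"

definition delete_vertex :: "('v, 'e, 'x) rhmap \<Rightarrow> 'v \<Rightarrow> ('v, 'e, 'x) rhmap" where
  "delete_vertex G v =
     (sub_hmap G {e \<in> hedges G. \<forall>x\<in>flags G. ed G x = e \<longrightarrow> vx G x \<noteq> v})
       \<lparr>hverts := hverts G - {v}\<rparr>"

definition edge_of_segment :: "('v, 'e, 'x) rhmap \<Rightarrow> 'x set \<Rightarrow> 'e" where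
  "edge_of_segment H c = the_elem (ed H ` c)"

text \<open>
  \<open>c1, c2, c3, c4\<close> are met in this order within a single turn around the boundary of \<open>v\<close>, in one of
  its two directions.
\<close>
definition in_cyclic_order ::
  "('v, 'e, 'x) rhmap \<Rightarrow> 'v \<Rightarrow> 'x set \<Rightarrow> 'x set \<Rightarrow> 'x set \<Rightarrow> 'x set \<Rightarrow> bool" where
  "in_cyclic_order H v c1 c2 c3 c4 \<longleftrightarrow>
     {c1, c2, c3, c4} \<subseteq> segments H \<and>
     (\<exists>x\<in>c1. vx H x = v \<and>
       (\<exists>i j k. 0 < i \<and> i < j \<and> j < k \<and> (\<forall>m\<in>{1..k}. (vnext H ^^ m) x \<noteq> x) \<and>
         (vnext H ^^ i) x \<in> c2 \<and> (vnext H ^^ j) x \<in> c3 \<and> (vnext H ^^ k) x \<in> c4))"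

definition central_connected :: "('v, 'e, 'x) rhmap \<Rightarrow> 'v \<Rightarrow> 'e \<Rightarrow> 'e \<Rightarrow> bool" where
  "central_connected H v e f \<longleftrightarrow>
     (Inl (Inr e), Inl (Inr f)) \<in> same_component (delete_vertex (ribbon_graph H) (Inl v))"

definition alternate ::
  "('v, 'e, 'x) rhmap \<Rightarrow> 'v \<Rightarrow> 'x set \<Rightarrow> 'x set \<Rightarrow> 'x set \<Rightarrow> 'x set \<Rightarrow> bool" where
  "alternate H v c1 c2 c3 c4 \<longleftrightarrow>
     in_cyclic_order H v c1 c2 c3 c4 \<and>
     (let e = edge_of_segment H c1; f = edge_of_segment H c2;
          g = edge_of_segment H c3; h = edge_of_segment H c4
      in central_connected H v e g \<and> central_connected H v f h \<and> \<not> central_connected H v e f)"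

text \<open>
  Adjacency in the intersection graph \<open>I(B)\<close>, whose vertex set is \<open>hedges B\<close>; \<open>the_elem (hverts B)\<close>
  is the unique hypervertex.
\<close>
definition intersection_adj :: "('v, 'e, 'x) rhmap \<Rightarrow> 'e \<Rightarrow> 'e \<Rightarrow> bool" where
  "intersection_adj B e f \<longleftrightarrow>
     (\<exists>c1 c2 c3 c4. alternate B (the_elem (hverts B)) c1 c2 c3 c4 \<and>
        edge_of_segment B c1 = e \<and> edge_of_segment B c2 = f \<and>
        edge_of_segment B c3 = e \<and> edge_of_segment B c4 = f)"

definition bipartite_graph :: "'a set \<Rightarrow> ('a \<Rightarrow> 'a \<Rightarrow> bool) \<Rightarrow> bool" where
  "bipartite_graph V adj \<longleftrightarrow>
     (\<exists>X Y. X \<union> Y = V \<and> X \<inter> Y = {} \<and>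
       (\<forall>u\<in>V. \<forall>w\<in>V. adj u w \<longrightarrow> (u \<in> X \<and> w \<in> Y) \<or> (u \<in> Y \<and> w \<in> X)))"

end

theory Submission
  imports Defs
begin

text \<open>
  Cut along its boundary, the hypervertex is a circle on which the involutions \<open>s = seg\<close> and \<open>v = varc\<close>
  alternate, so the flags are the \<open>2 m\<close> points of a circle and any fixed-point-free involution \<open>g\<close> is
  a chord diagram.  Take the orbits of \<open>s, g\<close> and of \<open>v, g\<close> as vertices and the chords as
  edges: this graph is connected, so there are at most \<open>m + 1\<close> orbits, with equality iff the graph is a
  tree, i.e. every chord is a bridge, i.e. no two chords cross.

  Let \<open>g\<^sub>A\<close> be \<open>earc\<close> on the hyperedges of \<open>A\<close> and \<open>seg\<close> on the others.  Its orbit count measures the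
  Euler genus of the sub-ribbon hypermap \<open>A\<close>, and the Euler genus of the partial dual with
  respect to \<open>A\<close> is the sum of the Euler genera of \<open>A\<close> and of its complement.  As chords of \<open>seg\<close> cross
  nothing, it vanishes iff \<open>earc\<close>-chords cross only between \<open>A\<close> and its complement.  Finally, two
  hyperedges are adjacent in the intersection graph iff some of their chords cross.
\<close>

subsection \<open>Trees, involutions and orbits\<close>

text \<open>The bound \<open>m + 1\<close> is the number of regions into which \<open>m\<close>
  disjoint chords cut a disc. Each flag separates a segment from an arc of the circle, and an
  uncrossed chord has ends of opposite parity, so every region touches either only segments or only
  arcs. The regions are therefore the two kinds of orbits, and the bipartite graph is the dual tree
  of the dissection. This is why orientability never has to be tested: a chord whose ends have equal
  parity, which is how a twist shows up, must be crossed by another chord. Chords end at flags and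
  not at segments, so the chords of a hyperedge of any degree have no end in common, and one
  numbering of the circle serves all subsets \<open>A\<close> at once. Two degenerate situations are
  treated apart: discs without flags, which cancel from the Euler genus, and a hypermap without any
  flags, for which there is no circle.\<close>

lemma image_Diff_redundant:
  assumes "E = S - {c}" "c \<in> S" "y \<in> E" "g y = g c"
  shows "g ` E = g ` S"
proof -
  have "g c \<in> g ` E" using assms(3,4) by (metis imageI)
  then show ?thesis using assms(1,2) by (metis image_insert insert_Diff insert_absorb)
qed

text \<open>\<open>E\<close> is the edge set of a bipartite multigraph in which \<open>e\<close> joins \<open>l e\<close> to \<open>r e\<close>.  It is connected in
  the first lemma, and every edge is a bridge in the second.\<close>

lemma tree_bound:
  assumes fin: "finite E" and ne: "E \<noteq> {}"
    and conn: "\<And>F. F \<subset> E \<Longrightarrow> F \<noteq> {} \<Longrightarrow> \<exists>e\<in>E - F. l e \<in> l ` F \<or> r e \<in> r ` F"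
  shows "card (l ` E) + card (r ` E) \<le> card E + 1"
proof -
  \<comment> \<open>A set of largest size among those satisfying the bound is chosen. A neighbouring
    edge shares an end with it and so brings at most one new vertex; by connectivity the maximum is
    all of \<open>E\<close>.\<close>
  define good where "good F \<longleftrightarrow> F \<subseteq> E \<and> F \<noteq> {} \<and> card (l ` F) + card (r ` F) \<le> card F + 1" for F
  obtain e0 where "e0 \<in> E" using ne by blast
  then have "good {e0}" by (simp add: good_def)
  moreover have "\<forall>F. good F \<longrightarrow> card F < Suc (card E)"
    using fin by (auto simp: good_def card_mono less_Suc_eq_le)
  ultimately have "\<exists>F. good F \<and> (\<forall>G. good G \<longrightarrow> card G \<le> card F)"
    by (rule Lattices_Big.ex_has_greatest_nat)
  then obtain F where F: "good F" and max: "\<And>G. good G \<Longrightarrow> card G \<le> card F" by auto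
  have "F = E"
  proof (rule ccontr)
    assume "F \<noteq> E"
    then have "F \<subset> E" "F \<noteq> {}" using F by (auto simp: good_def)
    from conn[OF this] obtain e where "e \<in> E - F" and le: "l e \<in> l ` F \<or> r e \<in> r ` F"
      by (elim bexE)
    then have e: "e \<in> E" "e \<notin> F" by simp_all
    have finF: "finite F" using F fin by (auto simp: good_def intro: finite_subset)
    have "card (l ` insert e F) + card (r ` insert e F) \<le> card (l ` F) + card (r ` F) + 1"
      using le
    proof
      assume "l e \<in> l ` F"
      then have "l ` insert e F = l ` F" by (simp add: insert_absorb)
      then show ?thesis using finF by (simp add: card_insert_if)
    next
      assume "r e \<in> r ` F"
      then have "r ` insert e F = r ` F" by (simp add: insert_absorb)
      then show ?thesis using finF by (simp add: card_insert_if)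
    qed
    then have "good (insert e F)"
      using F e finF by (auto simp: good_def)
    then show False using max[of "insert e F"] e finF by simp
  qed
  then show ?thesis using F by (simp add: good_def)
qed

lemma forest_bound:
  assumes "finite E" and "E \<noteq> {}"
    and "\<And>e. e \<in> E \<Longrightarrow> \<exists>P. (\<forall>x\<in>E - {e}. \<forall>y\<in>E - {e}. P x \<longrightarrow> \<not> P y \<longrightarrow> l x \<noteq> l y \<and> r x \<noteq> r y) \<and>
       (\<forall>x\<in>E - {e}. P x \<longrightarrow> r x \<noteq> r e) \<and> (\<forall>x\<in>E - {e}. \<not> P x \<longrightarrow> l x \<noteq> l e)"
  shows "card E + 1 \<le> card (l ` E) + card (r ` E)"
  using assms
proof (induction "card E" arbitrary: E rule: less_induct)
  case less
  obtain e where e: "e \<in> E" using less.prems by blast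
  obtain P where P: "(\<forall>x\<in>E - {e}. \<forall>y\<in>E - {e}. P x \<longrightarrow> \<not> P y \<longrightarrow> l x \<noteq> l y \<and> r x \<noteq> r y) \<and>
      (\<forall>x\<in>E - {e}. P x \<longrightarrow> r x \<noteq> r e) \<and> (\<forall>x\<in>E - {e}. \<not> P x \<longrightarrow> l x \<noteq> l e)"
    using less.prems(3)[OF e] by (elim exE)
  have bound: "F = {} \<or> card F + 1 \<le> card (l ` F) + card (r ` F)" if "F \<subseteq> E - {e}" for F
  proof (cases "F = {}")
    case False
    have "card F < card E"
      using that e by (intro psubset_card_mono less.prems(1)) blast
    moreover have "finite F" using that less.prems(1) by (meson finite_Diff finite_subset)
    ultimately have "card F + 1 \<le> card (l ` F) + card (r ` F)"
    proof (rule less.hyps[OF _ _ False])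
      fix c assume "c \<in> F"
      then have "c \<in> E" using that by auto
      from less.prems(3)[OF this] show "\<exists>P. (\<forall>x\<in>F - {c}. \<forall>y\<in>F - {c}. P x \<longrightarrow> \<not> P y \<longrightarrow> l x \<noteq> l y \<and> r x \<noteq> r y) \<and>
       (\<forall>x\<in>F - {c}. P x \<longrightarrow> r x \<noteq> r c) \<and> (\<forall>x\<in>F - {c}. \<not> P x \<longrightarrow> l x \<noteq> l c)"
        by (rule ex_forward) (use that in blast)
    qed
    then show ?thesis by simp
  qed simp
  \<comment> \<open>Without the bridge \<open>e\<close>, the other edges fall into those that can
    meet \<open>e\<close> only at \<open>l e\<close> and those that can meet it only at
    \<open>r e\<close>.\<close>
  define F G where "F = {x \<in> E - {e}. P x}" and "G = {x \<in> E - {e}. \<not> P x}"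
  have fin: "finite F" "finite G" using less.prems(1) by (auto simp: F_def G_def)
  have E: "E = insert e (F \<union> G)" "e \<notin> F" "e \<notin> G" "F \<inter> G = {}" using e by (auto simp: F_def G_def)
  have cE: "card E = card F + card G + 1"
    using E fin by (subst E(1)) (simp add: card_Un_disjoint)
  have "l ` E = insert (l e) (l ` F) \<union> l ` G" "r ` E = r ` F \<union> insert (r e) (r ` G)"
    by (auto simp: E(1))
  moreover have "insert (l e) (l ` F) \<inter> l ` G = {}" "r ` F \<inter> insert (r e) (r ` G) = {}"
    using P by (fastforce simp: F_def G_def)+
  ultimately have cl: "card (l ` E) = card (insert (l e) (l ` F)) + card (l ` G)"
    and cr: "card (r ` E) = card (r ` F) + card (insert (r e) (r ` G))"
    using fin by (metis card_Un_disjoint finite_imageI finite_insert)+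
  have sub: "F \<subseteq> E - {e}" "G \<subseteq> E - {e}" by (auto simp: F_def G_def)
  \<comment> \<open>Adding the end of \<open>e\<close> to its side yields the bound even for an
    empty side, where that end is the only vertex.\<close>
  have "card F + 1 \<le> card (insert (l e) (l ` F)) + card (r ` F)"
    using bound[OF sub(1)] card_insert_le[of "l ` F" "l e"] by auto
  moreover have "card G + 1 \<le> card (l ` G) + card (insert (r e) (r ` G))"
    using bound[OF sub(2)] card_insert_le[of "r ` G" "r e"] by auto
  ultimately show ?case using cE cl cr by linarith
qed

section \<open>Fixed-point-free involutions and the orbits of a pair of them\<close>

lemma fpf_involution_onD:
  assumes "fpf_involution_on X f" "x \<in> X"
  shows "f x \<in> X" "f x \<noteq> x" "f (f x) = x"
  using assms by (auto simp: fpf_involution_on_def)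

lemma card_fpf_pairs:
  assumes "finite X" "fpf_involution_on X f"
  shows "card X = 2 * card ((\<lambda>x. {x, f x}) ` X)"
proof -
  note f = fpf_involution_onD[OF assms(2)]
  have "2 * card ((\<lambda>x. {x, f x}) ` X) = card (\<Union> ((\<lambda>x. {x, f x}) ` X))"
  proof (rule card_partition)
    show "finite (\<Union> ((\<lambda>x. {x, f x}) ` X))" using assms(1) by auto
    show "card c = 2" if "c \<in> (\<lambda>x. {x, f x}) ` X" for c
      using that f(2) f(2)[THEN not_sym] by (auto simp: card_insert_if)
    show "c1 \<inter> c2 = {}" if "c1 \<in> (\<lambda>x. {x, f x}) ` X" "c2 \<in> (\<lambda>x. {x, f x}) ` X" "c1 \<noteq> c2" for c1 c2
      using that f(3) by (clarsimp simp: insert_commute) (metis insert_commute)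
  qed (use assms in auto)
  also have "\<Union> ((\<lambda>x. {x, f x}) ` X) = X" using f(1) by auto
  finally show ?thesis by simp
qed

lemma card_fpf_representatives:
  fixes p :: "'x \<Rightarrow> nat"
  assumes "finite X" "fpf_involution_on X f" "inj_on p X"
  shows "card X = 2 * card {x \<in> X. p x < p (f x)}"
proof -
  note f = fpf_involution_onD[OF assms(2)]
  let ?E = "{x \<in> X. p x < p (f x)}"
  have "X = ?E \<union> f ` ?E"
  proof
    show "X \<subseteq> ?E \<union> f ` ?E"
    proof
      fix x assume x: "x \<in> X"
      have "p x \<noteq> p (f x)" using x f assms(3) by (metis inj_onD)
      then consider "p x < p (f x)" | "p (f x) < p x" by linarith
      then show "x \<in> ?E \<union> f ` ?E"
      proof cases
        case 2
        then have "f x \<in> ?E" using x f by simp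
        then have "f (f x) \<in> f ` ?E" by blast
        then show ?thesis using f(3)[OF x] by simp
      qed (use x in auto)
    qed
  qed (use f in auto)
  moreover have "?E \<inter> f ` ?E = {}" using f by auto
  moreover have "card (f ` ?E) = card ?E"
    by (rule card_image) (rule inj_on_inverseI[of _ f], simp add: f(3))
  moreover have "card (?E \<union> f ` ?E) = card ?E + card (f ` ?E)"
    using \<open>?E \<inter> f ` ?E = {}\<close> assms(1) by (intro card_Un_disjoint) auto
  ultimately show ?thesis by simp
qed

lemma orbit_rel_commute: "orbit_rel X f g = orbit_rel X g f"
  by (simp add: orbit_rel_def disj_commute)

lemma orbit_rel_induct [consumes 1, case_names base step1 step2]:
  assumes "(x, y) \<in> orbit_rel X f g" and "P x"
    and "\<And>z. z \<in> X \<Longrightarrow> P z \<Longrightarrow> P (f z)" and "\<And>z. z \<in> X \<Longrightarrow> P z \<Longrightarrow> P (g z)"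
  shows "P y"
proof -
  have "(x, y) \<in> {(x, y). x \<in> X \<and> (y = f x \<or> y = g x)}\<^sup>*" using assms(1) by (simp add: orbit_rel_def)
  then show ?thesis by (induction rule: rtrancl_induct) (use assms(2-) in auto)
qed

lemma orbit_rel_refl: "x \<in> X \<Longrightarrow> (x, x) \<in> orbit_rel X f g"
  by (simp add: orbit_rel_def)

lemma orbit_rel_step:
  assumes "(x, y) \<in> orbit_rel X f g"
  shows "f y \<in> X \<Longrightarrow> (x, f y) \<in> orbit_rel X f g" "g y \<in> X \<Longrightarrow> (x, g y) \<in> orbit_rel X f g"
  using assms by (auto simp: orbit_rel_def intro: rtrancl_into_rtrancl)

lemma orbit_rel_trans:
  "(x, y) \<in> orbit_rel X f g \<Longrightarrow> (y, z) \<in> orbit_rel X f g \<Longrightarrow> (x, z) \<in> orbit_rel X f g"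
  by (auto simp: orbit_rel_def)

lemma equiv_orbit_rel:
  assumes f: "fpf_involution_on X f" and g: "fpf_involution_on X g"
  shows "equiv X (orbit_rel X f g)"
proof (rule equivI)
  note f = fpf_involution_onD[OF f] and g = fpf_involution_onD[OF g]
  let ?R = "orbit_rel X f g"
  show "?R \<subseteq> X \<times> X" by (simp add: orbit_rel_def)
  show "refl_on X ?R" by (auto simp: refl_on_def orbit_rel_def)
  show "trans ?R" by (rule transI) (rule orbit_rel_trans)
  show "sym ?R"
  proof (rule symI)
    fix x y assume xy: "(x, y) \<in> ?R"
    then have "x \<in> X" by (simp add: orbit_rel_def)
    with xy have "y \<in> X \<and> (y, x) \<in> ?R"
    proof (induction rule: orbit_rel_induct)
      case base then show ?case by (simp add: orbit_rel_refl)
    next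
      case (step1 z)
      have "(f z, z) \<in> ?R"
        using orbit_rel_step(1)[OF orbit_rel_refl[of "f z" X f g]] f step1 by simp
      then show ?case using step1 f(1) orbit_rel_trans[of "f z" z X f g x] by simp
    next
      case (step2 z)
      have "(g z, z) \<in> ?R"
        using orbit_rel_step(2)[OF orbit_rel_refl[of "g z" X f g]] g step2 by simp
      then show ?case using step2 g(1) orbit_rel_trans[of "g z" z X f g x] by simp
    qed
    then show "(y, x) \<in> ?R" by simp
  qed
qed

lemma card_quotient_image:
  assumes eq: "equiv X R" and k: "\<And>x y. x \<in> X \<Longrightarrow> y \<in> X \<Longrightarrow> (x, y) \<in> R \<longleftrightarrow> h x = h y"
  shows "card (X // R) = card (h ` X)"
proof -
  define k where "k c = h (SOME x. x \<in> c)" for c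
  have kx: "k (R `` {x}) = h x" if x: "x \<in> X" for x
  proof -
    have "x \<in> R `` {x}" using eq x by (rule equiv_class_self)
    then have "(SOME y. y \<in> R `` {x}) \<in> R `` {x}" by (metis someI)
    then have "(x, SOME y. y \<in> R `` {x}) \<in> R" by blast
    moreover have "(SOME y. y \<in> R `` {x}) \<in> X" using calculation eq by (auto simp: equiv_def)
    ultimately show ?thesis using k[OF x] by (metis k_def)
  qed
  have "inj_on k (X // R)"
  proof (rule inj_onI)
    fix c d assume "c \<in> X // R" "d \<in> X // R" and cd: "k c = k d"
    then obtain x y where "x \<in> X" "c = R `` {x}" "y \<in> X" "d = R `` {y}" by (meson quotientE)
    then show "c = d" using cd kx k eq by (metis equiv_class_eq)
  qed
  moreover have "k ` (X // R) = h ` X"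
  proof -
    have "X // R = (\<lambda>x. R `` {x}) ` X" by (auto simp: quotient_def)
    then show ?thesis by (simp add: image_image kx cong: image_cong)
  qed
  ultimately show ?thesis by (metis card_image)
qed

lemma orbit_class_eq_iff:
  assumes "fpf_involution_on X f" "fpf_involution_on X g" "x \<in> X" "y \<in> X"
  shows "orbit_rel X f g `` {x} = orbit_rel X f g `` {y} \<longleftrightarrow> (x, y) \<in> orbit_rel X f g"
  using equiv_orbit_rel[OF assms(1,2)] assms(3,4) by (metis eq_equiv_class_iff)

subsection \<open>Chord diagrams\<close>

text \<open>Only meaningful when the chords have no end in common; the parity form makes crossing additive.\<close>

definition cross :: "('x \<Rightarrow> nat) \<Rightarrow> 'x \<Rightarrow> 'x \<Rightarrow> 'x \<Rightarrow> 'x \<Rightarrow> bool" where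
  "cross p a a' b b' \<longleftrightarrow> ((p a < p b) \<noteq> (p a < p b')) \<noteq> ((p a' < p b) \<noteq> (p a' < p b'))"

definition noncrossing :: "('x \<Rightarrow> nat) \<Rightarrow> 'x set \<Rightarrow> ('x \<Rightarrow> 'x) \<Rightarrow> bool" where
  "noncrossing p X t \<longleftrightarrow> (\<forall>a\<in>X. \<forall>b\<in>X. b \<noteq> a \<longrightarrow> b \<noteq> t a \<longrightarrow> \<not> cross p a (t a) b (t b))"

lemma cross_swap_left: "cross p a' a b b' = cross p a a' b b'"
  by (auto simp: cross_def)

lemma cross_add_left: "cross p a a'' b b' \<longleftrightarrow> cross p a a' b b' \<noteq> cross p a' a'' b b'"
  by (auto simp: cross_def)

lemma cross_add_right: "cross p a a' b b'' \<longleftrightarrow> cross p a a' b b' \<noteq> cross p a a' b' b''"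
  by (auto simp: cross_def)

lemma interval_const:
  fixes P :: "nat \<Rightarrow> bool"
  assumes "\<And>i. lo \<le> i \<Longrightarrow> i < hi \<Longrightarrow> P i = P (Suc i)" "lo \<le> i" "i \<le> hi" "lo \<le> j" "j \<le> hi"
  shows "P i = P j"
proof -
  have "P (lo + k) = P lo" if "lo + k \<le> hi" for k
    using that
  proof (induction k)
    case (Suc k)
    then show ?case using assms(1)[of "lo + k"] by simp
  qed simp
  from this[of "i - lo"] this[of "j - lo"] show ?thesis using assms(2-) by simp
qed

text \<open>Positions \<open>2 * i\<close> and \<open>2 * i + 1\<close> are the two flags of one
  segment, so \<open>s\<close> never wraps around. Arcs join \<open>2 * i + 1\<close> to
  \<open>2 * i + 2\<close>, and a last arc closes the circle by joining \<open>2 * m - 1\<close> to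
  \<open>0\<close>.\<close>

locale circle =
  fixes X :: "'x set" and s v :: "'x \<Rightarrow> 'x" and p :: "'x \<Rightarrow> nat" and m :: nat
  assumes m_pos: "0 < m"
    and bij: "bij_betw p X {..<2 * m}"
    and s_in: "x \<in> X \<Longrightarrow> s x \<in> X"
    and v_in: "x \<in> X \<Longrightarrow> v x \<in> X"
    and p_s: "x \<in> X \<Longrightarrow> p (s x) = (if even (p x) then p x + 1 else p x - 1)"
    and p_v: "x \<in> X \<Longrightarrow> p (v x) = (if even (p x) then if p x = 0 then 2 * m - 1 else p x - 1
         else if p x = 2 * m - 1 then 0 else p x + 1)"
begin

lemma fin: "finite X"
  using bij bij_betw_finite by blast

lemma card_X: "card X = 2 * m"
  using bij bij_betw_same_card by fastforce

lemma inj: "inj_on p X"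
  using bij by (simp add: bij_betw_def)

lemma p_eq: "x \<in> X \<Longrightarrow> y \<in> X \<Longrightarrow> p x = p y \<longleftrightarrow> x = y"
  using inj by (auto dest: inj_onD)

lemma p_less: "x \<in> X \<Longrightarrow> p x < 2 * m"
  using bij by (auto simp: bij_betw_def)

lemma s_inv: "fpf_involution_on X s"
  unfolding fpf_involution_on_def
proof (intro ballI conjI)
  fix x assume x: "x \<in> X"
  show "s x \<in> X" using s_in x .
  have "p (s x) \<noteq> p x" using p_s[OF x] by (auto elim: oddE)
  then show "s x \<noteq> x" by auto
  have "p (s (s x)) = p x" using p_s[OF x] p_s[OF s_in[OF x]] by (auto elim: oddE)
  then show "s (s x) = x" using x s_in p_eq by blast
qed

lemma v_inv: "fpf_involution_on X v"
  unfolding fpf_involution_on_def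
proof (intro ballI conjI)
  fix x assume x: "x \<in> X"
  show "v x \<in> X" using v_in x .
  have "p (v x) \<noteq> p x" using p_v[OF x] m_pos by (auto elim: oddE evenE split: if_splits)
  then show "v x \<noteq> x" by auto
  have "even (p (v x)) \<longleftrightarrow> odd (p x)" using p_v[OF x] m_pos by (auto split: if_splits)
  then have "p (v (v x)) = p x" using p_v[OF x] p_v[OF v_in[OF x]] m_pos p_less[OF x]
    by (auto split: if_splits)
  then show "v (v x) = x" using x v_in p_eq by blast
qed

text \<open>Exchanging the chords negates all four comparisons of positions, which leaves their
  parity unchanged; without a common end there are no ties to spoil this.\<close>

lemma cross_commute:
  assumes "{a, a', b, b'} \<subseteq> X" "{a, a'} \<inter> {b, b'} = {}"
  shows "cross p a a' b b' = cross p b b' a a'"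
proof -
  have "p a \<noteq> p b" "p a \<noteq> p b'" "p a' \<noteq> p b" "p a' \<noteq> p b'"
    using assms p_eq by auto
  then show ?thesis by (auto simp: cross_def)
qed

text \<open>The ends of a segment occupy consecutive positions, so any other flag compares equally
  with both.\<close>

lemma not_cross_s:
  assumes "a \<in> X" "{b, b'} \<subseteq> X" "{a, s a} \<inter> {b, b'} = {}"
  shows "\<not> cross p a (s a) b b'"
proof -
  have "p a \<noteq> p b" "p a \<noteq> p b'" "p (s a) \<noteq> p b" "p (s a) \<noteq> p b'"
    using assms p_eq s_in by auto
  then show ?thesis using p_s[OF assms(1)] by (auto simp: cross_def elim!: oddE split: if_splits)
qed

text \<open>The closing arc is the exception to consecutive positions: its ends are the extreme
  ones, so every other flag lies between them, and again the second chord does not change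
  sides.\<close>

lemma not_cross_v:
  assumes "a \<in> X" "{b, b'} \<subseteq> X" "{a, v a} \<inter> {b, b'} = {}"
  shows "\<not> cross p a (v a) b b'"
proof -
  have "p a \<noteq> p b" "p a \<noteq> p b'" "p (v a) \<noteq> p b" "p (v a) \<noteq> p b'"
    using assms p_eq v_in by auto
  moreover have "p b < 2 * m" "p b' < 2 * m" using assms p_less by auto
  ultimately show ?thesis using p_v[OF assms(1)]
    by (auto simp: cross_def elim!: oddE split: if_splits)
qed

definition flag_at :: "nat \<Rightarrow> 'x" where "flag_at i = inv_into X p i"

lemma flag_at: "i < 2 * m \<Longrightarrow> flag_at i \<in> X" "i < 2 * m \<Longrightarrow> p (flag_at i) = i"
  using bij by (auto simp: flag_at_def bij_betw_def inv_into_into f_inv_into_f)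

lemma flag_at_p: "x \<in> X \<Longrightarrow> flag_at (p x) = x"
  using inj by (simp add: flag_at_def)

lemma flag_at_Suc:
  assumes "Suc i < 2 * m"
  shows "flag_at (Suc i) = (if even i then s (flag_at i) else v (flag_at i))"
proof -
  have "p (if even i then s (flag_at i) else v (flag_at i)) = Suc i"
    using p_s[of "flag_at i"] p_v[of "flag_at i"] flag_at[of i] assms by simp
  then show ?thesis using flag_at_p[of "if even i then s (flag_at i) else v (flag_at i)"] flag_at[of i] assms s_in v_in by simp
qed

lemma v_flag_at_0: "v (flag_at 0) = flag_at (2 * m - 1)"
proof -
  have "p (v (flag_at 0)) = 2 * m - 1" using p_v[of "flag_at 0"] flag_at[of 0] m_pos by simp
  then show ?thesis using flag_at_p[of "v (flag_at 0)"] flag_at[of 0] m_pos v_in by simp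
qed

lemma closed_eq_X:
  assumes Q: "Q \<subseteq> X" "Q \<noteq> {}" "\<And>x. x \<in> Q \<Longrightarrow> s x \<in> Q" "\<And>x. x \<in> Q \<Longrightarrow> v x \<in> Q"
  shows "Q = X"
proof -
  obtain x where x: "x \<in> Q" using Q(2) by blast
  have iff: "s z \<in> Q \<longleftrightarrow> z \<in> Q" "v z \<in> Q \<longleftrightarrow> z \<in> Q" if "z \<in> X" for z
    using Q(3,4) fpf_involution_onD(3)[OF s_inv that] fpf_involution_onD(3)[OF v_inv that] by metis+
  have "flag_at i \<in> Q \<longleftrightarrow> flag_at j \<in> Q" if "i < 2 * m" "j < 2 * m" for i j
  proof (rule interval_const[of 0 "2 * m - 1"])
    show "(flag_at k \<in> Q) = (flag_at (Suc k) \<in> Q)" if "k < 2 * m - 1" for k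
      using that flag_at_Suc[of k] iff flag_at[of k] by simp
  qed (use that in auto)
  then have "y \<in> Q" if "y \<in> X" for y
    using flag_at_p[of x] flag_at_p[OF that] p_less[of x] p_less[OF that] x Q(1) by (metis subsetD)
  then show ?thesis using Q(1) by blast
qed

text \<open>The flags other than \<open>a\<close> and \<open>c\<close> form two arcs, on each of which membership in \<open>Q\<close> is constant;
  \<open>b\<close> and \<open>b'\<close> lie on different arcs and link them.\<close>

lemma crossed_chord_classes:
  assumes X': "X' = X - {a, c}" and ac: "a \<in> X" "c \<in> X" "p a < p c"
    and Q: "\<And>x. x \<in> X' \<Longrightarrow> s x \<in> X' \<Longrightarrow> x \<in> Q \<longleftrightarrow> s x \<in> Q"
      "\<And>x. x \<in> X' \<Longrightarrow> v x \<in> X' \<Longrightarrow> x \<in> Q \<longleftrightarrow> v x \<in> Q"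
    and b: "b \<in> X'" "b' \<in> X'" "b \<in> Q \<longleftrightarrow> b' \<in> Q" "cross p a c b b'"
    and xy: "x \<in> X'" "y \<in> X'"
  shows "x \<in> Q \<longleftrightarrow> y \<in> Q"
proof -
  define P where "P i \<longleftrightarrow> flag_at i \<in> Q" for i
  have PQ: "P (p x) \<longleftrightarrow> x \<in> Q" if "x \<in> X" for x using that flag_at_p by (simp add: P_def)
  have atX': "flag_at i \<in> X'" if "i < 2 * m" "i \<noteq> p a" "i \<noteq> p c" for i
    using that flag_at[OF that(1)] X' by auto
  have step: "P i = P (Suc i)"
    if "Suc i < 2 * m" "i \<noteq> p a" "i \<noteq> p c" "Suc i \<noteq> p a" "Suc i \<noteq> p c" for i
    using Q[of "flag_at i"] flag_at_Suc[OF that(1)] atX'[of i] atX'[of "Suc i"] that by (simp add: P_def split: if_splits)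
  \<comment> \<open>The stretches below \<open>p a\<close> and above \<open>p c\<close> are joined
    through the closing arc. If a chord end sits at position \<open>0\<close> or
    \<open>2 * m - 1\<close>, one of the stretches is empty.\<close>
  have wrap: "P (2 * m - 1) = P 0" if "0 \<noteq> p a" "2 * m - 1 \<noteq> p c"
  proof -
    have "0 \<noteq> p c" "2 * m - 1 \<noteq> p a" using ac p_less[of c] by auto
    then show ?thesis
      using Q(2)[of "flag_at 0"] v_flag_at_0 atX'[of 0] atX'[of "2 * m - 1"] that m_pos by (simp add: P_def)
  qed
  have inner: "P i = P j" if "p a < i" "i < p c" "p a < j" "j < p c" for i j
  proof (rule interval_const[of "Suc (p a)" "p c - 1"])
    show "P k = P (Suc k)" if "Suc (p a) \<le> k" "k < p c - 1" for k
      using that p_less[OF ac(2)] by (intro step) auto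
  qed (use that in auto)
  have low: "P i = P j" if "i < p a" "j < p a" for i j
  proof (rule interval_const[of 0 "p a - 1"])
    show "P k = P (Suc k)" if "k < p a - 1" for k
      using that p_less[OF ac(1)] ac(3) by (intro step) auto
  qed (use that in auto)
  have high: "P i = P j" if "p c < i" "i < 2 * m" "p c < j" "j < 2 * m" for i j
  proof (rule interval_const[of "Suc (p c)" "2 * m - 1"])
    show "P k = P (Suc k)" if "Suc (p c) \<le> k" "k < 2 * m - 1" for k
      using that ac(3) by (intro step) auto
  qed (use that in auto)
  have outer: "P i = P j" if "i < p a \<or> p c < i \<and> i < 2 * m" "j < p a \<or> p c < j \<and> j < 2 * m" for i j
  proof -
    have *: "P i = P j" if "i < p a" "p c < j" "j < 2 * m" for i j
      using low[of i 0] high[of j "2 * m - 1"] wrap that by auto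
    show ?thesis using that low high *[of i j] *[of j i] by blast
  qed
  have pos: "p z < 2 * m" "p z \<noteq> p a" "p z \<noteq> p c" if "z \<in> X'" for z
    using that p_less p_eq ac X' by auto
  define I where "I z \<longleftrightarrow> p a < p z \<and> p z < p c" for z
  have same: "z \<in> Q \<longleftrightarrow> w \<in> Q" if "z \<in> X'" "w \<in> X'" "I z = I w" for z w
    using inner[of "p z" "p w"] outer[of "p z" "p w"] pos[OF that(1)] pos[OF that(2)] that PQ X'
    by (auto simp: I_def)
  have "I b \<noteq> I b'"
    using b(4) pos[OF b(1)] pos[OF b(2)] ac(3) by (auto simp: cross_def I_def)
  then show ?thesis using same b xy by metis
qed

section \<open>The bipartite graph of a chord diagram\<close>

context
  fixes t :: "'x \<Rightarrow> 'x"
  assumes t: "fpf_involution_on X t"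
begin

definition reps :: "'x set" where "reps = {x \<in> X. p x < p (t x)}"

lemma card_reps: "card reps = m"
  using card_fpf_representatives[OF fin t inj] card_X by (simp add: reps_def)

lemma finite_reps: "finite reps"
  using fin by (simp add: reps_def)

lemma reps_cases: "x \<in> X \<Longrightarrow> x \<in> reps \<or> t x \<in> reps"
proof -
  assume x: "x \<in> X"
  note tx = fpf_involution_onD[OF t x]
  have "p x \<noteq> p (t x)" using p_eq[OF x tx(1)] tx(2) by auto
  then show ?thesis using x tx(1,3) unfolding reps_def by (metis (mono_tags) CollectI linorder_neqE_nat)
qed

lemma orbit_class_step:
  assumes f: "fpf_involution_on X f" and x: "x \<in> X"
  shows "orbit_rel X f t `` {f x} = orbit_rel X f t `` {x}"
    "orbit_rel X f t `` {t x} = orbit_rel X f t `` {x}"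
proof -
  have "f x \<in> X" "t x \<in> X"
    using fpf_involution_onD(1)[OF t x] fpf_involution_onD(1)[OF f x] by auto
  moreover from this have "(x, f x) \<in> orbit_rel X f t" "(x, t x) \<in> orbit_rel X f t"
    using orbit_rel_step[OF orbit_rel_refl[OF x]] by blast+
  ultimately show "orbit_rel X f t `` {f x} = orbit_rel X f t `` {x}"
    "orbit_rel X f t `` {t x} = orbit_rel X f t `` {x}"
    using orbit_class_eq_iff[OF f t x] by blast+
qed

lemma quotient_reps:
  assumes f: "fpf_involution_on X f"
  shows "X // orbit_rel X f t = (\<lambda>x. orbit_rel X f t `` {x}) ` reps"
proof
  let ?R = "orbit_rel X f t"
  note t' = fpf_involution_onD[OF t]
  show "X // ?R \<subseteq> (\<lambda>x. ?R `` {x}) ` reps"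
  proof
    fix c assume "c \<in> X // ?R"
    then obtain x where x: "x \<in> X" "c = ?R `` {x}" by (meson quotientE)
    then have "c = ?R `` {t x}" using orbit_class_step(2)[OF f x(1)] by simp
    then show "c \<in> (\<lambda>x. ?R `` {x}) ` reps" using reps_cases[OF x(1)] x(2) by blast
  qed
qed (auto simp: reps_def quotient_def)

text \<open>Supplies the connectivity required by \<open>chord_graph_bound\<close> when one crossed
  chord is left out: a crossed chord is no bridge.\<close>

lemma crossed_chord_closed:
  assumes a: "a \<in> X" and b: "b \<in> X" "b \<noteq> a" "b \<noteq> t a" and cr: "cross p a (t a) b (t b)"
    and Q: "Q \<subseteq> X - {a, t a}" "Q \<noteq> {}" "\<And>x. x \<in> Q \<Longrightarrow> t x \<in> Q"
      "\<And>x. x \<in> Q \<Longrightarrow> s x \<in> X - {a, t a} \<Longrightarrow> s x \<in> Q"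
      "\<And>x. x \<in> Q \<Longrightarrow> v x \<in> X - {a, t a} \<Longrightarrow> v x \<in> Q"
  shows "Q = X - {a, t a}"
proof -
  note t' = fpf_involution_onD[OF t] and s' = fpf_involution_onD[OF s_inv] and v' = fpf_involution_onD[OF v_inv]
  \<comment> \<open>Here \<open>c\<close> is whichever end of the chord comes first, because the
    argument with two arcs wants the ends in increasing order.\<close>
  have main: "x \<in> Q \<longleftrightarrow> y \<in> Q" if "c \<in> X" "p c < p (t c)" "{c, t c} = {a, t a}" "cross p c (t c) b (t b)"
    "x \<in> X - {a, t a}" "y \<in> X - {a, t a}" for c x y
  proof (rule crossed_chord_classes[where a = c and c = "t c" and X' = "X - {a, t a}" and b = b and b' = "t b"])
    show "X - {a, t a} = X - {c, t c}" using that(3) by simp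
    show "t c \<in> X" using t' that(1) by simp
    show "x \<in> Q \<longleftrightarrow> s x \<in> Q" if "x \<in> X - {a, t a}" "s x \<in> X - {a, t a}" for x
      using Q(4)[of x] Q(4)[of "s x"] that s'(3)[of x] by auto
    show "x \<in> Q \<longleftrightarrow> v x \<in> Q" if "x \<in> X - {a, t a}" "v x \<in> X - {a, t a}" for x
      using Q(5)[of x] Q(5)[of "v x"] that v'(3)[of x] by auto
    show "b \<in> X - {a, t a}" using b by simp
    show "t b \<in> X - {a, t a}" using b t'(1,3)[OF b(1)] t'(3)[OF a] by (metis DiffI insertE singletonD)
    show "b \<in> Q \<longleftrightarrow> t b \<in> Q" using Q(3)[of b] Q(3)[of "t b"] t'(3)[OF b(1)] by auto
  qed (rule that)+
  have "x \<in> Q \<longleftrightarrow> y \<in> Q" if "x \<in> X - {a, t a}" "y \<in> X - {a, t a}" for x y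
  proof (cases "p a < p (t a)")
    case True
    show ?thesis by (rule main[OF a True refl cr that])
  next
    case False
    then have "p (t a) < p (t (t a))" using p_eq[of a "t a"] t'[OF a] a by simp
    moreover have "{t a, t (t a)} = {a, t a}" using t'(3)[OF a] by auto
    moreover have "cross p (t a) (t (t a)) b (t b)" using t'(3)[OF a] cr by (simp add: cross_swap_left)
    ultimately show ?thesis using main[OF t'(1)[OF a] _ _ _ that] by blast
  qed
  then show ?thesis using Q(1,2) by blast
qed

text \<open>The orbits of \<open>s, t\<close> and of \<open>v, t\<close> are the vertices and the chords of \<open>t\<close> the edges of a
  bipartite graph, which is connected because the circle is.  The chords in \<open>D\<close> are left out.\<close>

lemma chord_graph_bound:
  assumes D: "D \<subset> X" "\<And>x. x \<in> D \<Longrightarrow> t x \<in> D"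
    and conn: "\<And>Q. Q \<subseteq> X - D \<Longrightarrow> Q \<noteq> {} \<Longrightarrow> (\<And>x. x \<in> Q \<Longrightarrow> t x \<in> Q) \<Longrightarrow>
      (\<And>x. x \<in> Q \<Longrightarrow> s x \<in> X - D \<Longrightarrow> s x \<in> Q) \<Longrightarrow> (\<And>x. x \<in> Q \<Longrightarrow> v x \<in> X - D \<Longrightarrow> v x \<in> Q) \<Longrightarrow>
      Q = X - D"
  shows "card ((\<lambda>x. orbit_rel X s t `` {x}) ` (reps - D)) + card ((\<lambda>x. orbit_rel X v t `` {x}) ` (reps - D))
    \<le> card (reps - D) + 1"
proof (rule tree_bound)
  note t' = fpf_involution_onD[OF t]
  let ?E = "reps - D"
  let ?l = "\<lambda>x. orbit_rel X s t `` {x}" and ?r = "\<lambda>x. orbit_rel X v t `` {x}"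
  have l: "?l (s x) = ?l x" "?l (t x) = ?l x" and r: "?r (v x) = ?r x" "?r (t x) = ?r x" if "x \<in> X" for x
    using orbit_class_step[OF s_inv that] orbit_class_step[OF v_inv that] by simp_all
  have tD: "t x \<in> X - D" if "x \<in> X - D" for x
    using D(2)[of "t x"] t'[of x] that by auto
  have rep: "\<exists>y\<in>?E. y = x \<or> y = t x" if "x \<in> X - D" for x
    using reps_cases[of x] tD[OF that] that by blast
  show "finite ?E" using finite_reps by simp
  show "?E \<noteq> {}" using rep D(1) by blast
  fix F assume F: "F \<subset> ?E" "F \<noteq> {}"
  show "\<exists>e\<in>?E - F. ?l e \<in> ?l ` F \<or> ?r e \<in> ?r ` F"
  proof (rule ccontr)
    assume no: "\<not> (\<exists>e\<in>?E - F. ?l e \<in> ?l ` F \<or> ?r e \<in> ?r ` F)"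
    \<comment> \<open>If no further chord is attached to \<open>F\<close>, the flags of its chords
      are closed under all moves, so connectivity makes them everything.\<close>
    define Q where "Q = F \<union> t ` F"
    have FX: "F \<subseteq> X - D" using F by (auto simp: reps_def)
    then have QX: "Q \<subseteq> X - D" using tD by (auto simp: Q_def)
    have lr: "\<exists>y\<in>F. ?l y = ?l x \<and> ?r y = ?r x" if x: "x \<in> Q" for x
    proof -
      obtain y where y: "y \<in> F" "x = y \<or> x = t y" using x by (auto simp: Q_def)
      then show ?thesis using l(2)[of y] r(2)[of y] FX by (intro bexI[of _ y]) auto
    qed
    have absorb: "x \<in> Q" if x: "x \<in> X - D" and z: "z \<in> Q" "?l x = ?l z \<or> ?r x = ?r z" for x z
    proof -
      obtain y where y: "y \<in> ?E" "y = x \<or> y = t x" using rep[OF x] by blast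
      obtain w where w: "w \<in> F" "?l w = ?l z" "?r w = ?r z" using lr[OF z(1)] by blast
      have "?l y = ?l x" "?r y = ?r x" using y(2) l(2)[of x] r(2)[of x] x by auto
      then have "?l y = ?l w \<or> ?r y = ?r w" using w z(2) by simp
      then have "?l y \<in> ?l ` F \<or> ?r y \<in> ?r ` F" using w(1) by blast
      then have "y \<in> F" using no y(1) by blast
      then have "x \<in> {y, t y}" "y \<in> Q" "t y \<in> Q" using y(2) t'(3)[of x] x by (auto simp: Q_def)
      then show ?thesis by blast
    qed
    have "Q = X - D"
    proof (rule conn[OF QX])
      show "Q \<noteq> {}" using F by (simp add: Q_def)
      show "t x \<in> Q" if x: "x \<in> Q" for x
      proof -
        obtain y where y: "y \<in> F" "x = y \<or> x = t y" using x unfolding Q_def by blast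
        then show ?thesis using t'(3)[of y] FX by (auto simp: Q_def)
      qed
      show "s x \<in> Q" if "x \<in> Q" "s x \<in> X - D" for x
        using absorb[OF that(2,1)] l(1)[of x] QX that(1) by blast
      show "v x \<in> Q" if "x \<in> Q" "v x \<in> X - D" for x
        using absorb[OF that(2,1)] r(1)[of x] QX that(1) by blast
    qed
    then have "?E \<subseteq> Q" by (auto simp: reps_def)
    \<comment> \<open>The involution sends lower ends to upper ends, so a lower end found in
      \<open>Q\<close> already belongs to \<open>F\<close>.\<close>
    moreover have "?E \<inter> t ` F = {}"
    proof -
      have "t y \<notin> reps" if "y \<in> F" for y
      proof -
        have "y \<in> reps" using F that by blast
        then show ?thesis using t'(3)[of y] by (auto simp: reps_def)
      qed
      then show ?thesis by blast
    qed
    ultimately show False using F unfolding Q_def by blast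
  qed
qed

lemma orbits_le: "card (X // orbit_rel X s t) + card (X // orbit_rel X v t) \<le> m + 1"
proof -
  let ?l = "\<lambda>x. orbit_rel X s t `` {x}" and ?r = "\<lambda>x. orbit_rel X v t `` {x}"
  have "card (?l ` (reps - {})) + card (?r ` (reps - {})) \<le> card (reps - {}) + 1"
  proof (rule chord_graph_bound)
    show "{} \<subset> X" using card_X m_pos by auto
    fix Q assume Q: "Q \<subseteq> X - {}" "Q \<noteq> {}" "\<And>x. x \<in> Q \<Longrightarrow> s x \<in> X - {} \<Longrightarrow> s x \<in> Q"
      "\<And>x. x \<in> Q \<Longrightarrow> v x \<in> X - {} \<Longrightarrow> v x \<in> Q"
    have "Q = X"
    proof (rule closed_eq_X)
      show "s x \<in> Q" "v x \<in> Q" if "x \<in> Q" for x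
        using Q(1) Q(3,4)[of x] s_in[of x] v_in[of x] that by auto
    qed (use Q in auto)
    then show "Q = X - {}" by simp
  qed simp
  then show ?thesis
    by (simp add: quotient_reps[OF s_inv] quotient_reps[OF v_inv] card_reps)
qed

text \<open>Removing a crossed chord leaves a connected graph with \<open>m - 1\<close> edges. No
  vertex is lost: the \<open>s\<close>-orbit of the chord still carries the chord at
  \<open>s a\<close>, and its \<open>v\<close>-orbit the chord at \<open>v a\<close>.\<close>

lemma orbits_less:
  assumes a: "a \<in> X" and b: "b \<in> X" "b \<noteq> a" "b \<noteq> t a" and cr: "cross p a (t a) b (t b)"
  shows "card (X // orbit_rel X s t) + card (X // orbit_rel X v t) \<le> m"
proof -
  note t' = fpf_involution_onD[OF t] and s' = fpf_involution_onD[OF s_inv] and v' = fpf_involution_onD[OF v_inv]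
  let ?D = "{a, t a}" and ?E = "reps - {a, t a}"
  let ?l = "\<lambda>x. orbit_rel X s t `` {x}" and ?r = "\<lambda>x. orbit_rel X v t `` {x}"
  have lr: "?l (s a) = ?l a" "?r (v a) = ?r a" "?l (t x) = ?l x" "?r (t x) = ?r x" if "x \<in> X" for x
    using orbit_class_step[OF s_inv] orbit_class_step[OF v_inv] a that by blast+
  have tb: "t b \<noteq> a" "t b \<noteq> t a" using t'(3)[OF a] t'(3)[OF b(1)] b by metis+
  then have disj: "{a, t a} \<inter> {b, t b} = {}" using b by auto
  \<comment> \<open>A chord running along a segment or an arc is crossed by nothing, so the chords
    at \<open>s a\<close> and \<open>v a\<close> differ from the chord at \<open>a\<close>.\<close>
  have "s a \<noteq> t a" using not_cross_s[of a b "t b"] cr disj a b(1) t'(1) by auto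
  moreover have "v a \<noteq> t a" using not_cross_v[of a b "t b"] cr disj a b(1) t'(1) by auto
  ultimately have sub: "s a \<in> X - ?D" "v a \<in> X - ?D" using s'(1,2)[OF a] v'(1,2)[OF a] by auto
  have rep: "\<exists>y\<in>?E. y = x \<or> y = t x" if "x \<in> X - ?D" for x
  proof -
    have "t x \<noteq> a" "t x \<noteq> t a" using t'(3)[of x] t'(3)[OF a] that by auto
    then show ?thesis using reps_cases[of x] that by auto
  qed
  have D: "?E = reps - {if a \<in> reps then a else t a}" "(if a \<in> reps then a else t a) \<in> reps"
    using reps_cases[OF a] t'(3)[OF a] by (auto simp: reps_def)
  have "?l ` ?E = ?l ` reps"
  proof -
    obtain y where y: "y \<in> ?E" "y = s a \<or> y = t (s a)" using rep[OF sub(1)] by blast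
    then have "?l y = ?l (if a \<in> reps then a else t a)"
      using lr(1)[OF a] lr(3)[OF a] lr(3)[of "s a"] sub(1) by auto
    then show ?thesis using D y(1) by (intro image_Diff_redundant)
  qed
  moreover have "?r ` ?E = ?r ` reps"
  proof -
    obtain y where y: "y \<in> ?E" "y = v a \<or> y = t (v a)" using rep[OF sub(2)] by blast
    then have "?r y = ?r (if a \<in> reps then a else t a)"
      using lr(2)[OF a] lr(4)[OF a] lr(4)[of "v a"] sub(2) by auto
    then show ?thesis using D y(1) by (intro image_Diff_redundant)
  qed
  moreover have "card (?l ` ?E) + card (?r ` ?E) \<le> card ?E + 1"
  proof (rule chord_graph_bound)
    show "?D \<subset> X" using a t'(1)[OF a] b by auto
    show "t x \<in> ?D" if "x \<in> ?D" for x using that t'(3)[OF a] by auto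
  qed (rule crossed_chord_closed[OF a b cr])
  moreover have "card ?E + 1 = m"
    using D finite_reps card_reps m_pos by (simp add: card_Diff_singleton)
  ultimately show ?thesis by (simp add: quotient_reps[OF s_inv] quotient_reps[OF v_inv])
qed

end

end

section \<open>Uncrossed chords as bridges\<close>

lemma orbit_class_separated:
  assumes "Q \<subseteq> X" "\<And>z. z \<in> Q \<Longrightarrow> f z \<in> Q" "\<And>z. z \<in> Q \<Longrightarrow> g z \<in> Q" "x \<in> Q" "y \<in> X" "y \<notin> Q"
  shows "orbit_rel X f g `` {x} \<noteq> orbit_rel X f g `` {y}"
proof
  assume eq: "orbit_rel X f g `` {x} = orbit_rel X f g `` {y}"
  have "(y, y) \<in> orbit_rel X f g" using assms(5) by (rule orbit_rel_refl)
  then have "(x, y) \<in> orbit_rel X f g" using eq by blast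
  then have "y \<in> Q"
    by (induction rule: orbit_rel_induct) (use assms in auto)
  then show False using assms(6) by simp
qed

text \<open>Segments are pairs of positions \<open>2 * i\<close>, \<open>2 * i + 1\<close>. The
  closed interval from an even to an odd position is a union of such pairs, and so is the open
  interval from an odd to an even one.\<close>

lemma segment_step_bounds:
  fixes a c i :: nat
  shows "even a \<Longrightarrow> odd c \<Longrightarrow> a \<le> i \<Longrightarrow> i \<le> c \<Longrightarrow>
      a \<le> (if even i then i + 1 else i - 1) \<and> (if even i then i + 1 else i - 1) \<le> c"
    and "odd a \<Longrightarrow> even c \<Longrightarrow> a < i \<Longrightarrow> i < c \<Longrightarrow>
      a < (if even i then i + 1 else i - 1) \<and> (if even i then i + 1 else i - 1) < c"
  by (cases "even i"; simp; presburger)+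

text \<open>For arcs open and closed intervals exchange roles. The positions \<open>i\<close>
  concerned avoid \<open>0\<close> and \<open>2 * m - 1\<close>, so the closing arc does not
  interfere.\<close>

lemma arc_step_bounds:
  fixes a c i m :: nat
  defines "j \<equiv> if even i then if i = 0 then 2 * m - 1 else i - 1 else if i = 2 * m - 1 then 0 else i + 1"
  shows "even a \<Longrightarrow> odd c \<Longrightarrow> a < i \<Longrightarrow> i < c \<Longrightarrow> c < 2 * m \<Longrightarrow> a < j \<and> j < c"
    and "odd a \<Longrightarrow> even c \<Longrightarrow> a \<le> i \<Longrightarrow> i \<le> c \<Longrightarrow> c < 2 * m \<Longrightarrow> a \<le> j \<and> j \<le> c"
  unfolding j_def by (cases "even i"; simp split: if_splits; presburger)+

context circle
begin

context
  fixes t :: "'x \<Rightarrow> 'x"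
  assumes t: "fpf_involution_on X t"
begin

text \<open>A chord \<open>{a, t a}\<close> crossed by no other is a bridge: an even number of flags lies strictly between
  its ends, so either \<open>S\<close> is closed under \<open>v\<close> and \<open>S'\<close> under \<open>s\<close>, or the other way round.\<close>

lemma noncrossing_bound:
  assumes nc: "noncrossing p X t"
  shows "m + 1 \<le> card (X // orbit_rel X s t) + card (X // orbit_rel X v t)"
proof -
  let ?l = "\<lambda>x. orbit_rel X s t `` {x}" and ?r = "\<lambda>x. orbit_rel X v t `` {x}"
  have "card (reps t) + 1 \<le> card (?l ` reps t) + card (?r ` reps t)"
  proof (rule forest_bound)
    show "finite (reps t)" using finite_reps[OF t] .
    show "reps t \<noteq> {}" using card_reps[OF t] m_pos by auto
    fix a assume "a \<in> reps t"
    then have a: "a \<in> X" "p a < p (t a)" by (auto simp: reps_def[OF t])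
    note ta = fpf_involution_onD[OF t a(1)]
    define S where "S = {x \<in> X. p a < p x \<and> p x < p (t a)}"
    define S' where "S' = {x \<in> X. p a \<le> p x \<and> p x \<le> p (t a)}"
    have SX: "S \<subseteq> X" "S' \<subseteq> X" "S \<subseteq> S'" "a \<in> S'" "a \<notin> S" "t a \<in> S'" "t a \<notin> S" using a ta(1) by (auto simp: S_def S'_def)
    have tS: "t x \<in> S" if x: "x \<in> S" for x
    proof -
      have xX: "x \<in> X" "x \<noteq> a" "x \<noteq> t a" using x by (auto simp: S_def)
      note tx = fpf_involution_onD[OF t xX(1)]
      have "\<not> cross p a (t a) x (t x)" using nc a(1) xX by (simp add: noncrossing_def)
      moreover have "t x \<noteq> a" "t x \<noteq> t a" using tx(3) ta(3) xX by auto
      then have "p (t x) \<noteq> p a" "p (t x) \<noteq> p (t a)" using p_eq tx(1) ta(1) a(1) by blast+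
      ultimately show ?thesis using x a(2) tx(1) by (auto simp: S_def cross_def)
    qed
    have S'eq: "x = a \<or> x = t a \<or> x \<in> S" if "x \<in> S'" for x
      using that p_eq[of x a] p_eq[of x "t a"] a(1) ta(1) by (auto simp: S_def S'_def)
    have tS': "t x \<in> S'" if "x \<in> S'" for x
      using S'eq[OF that] tS[of x] SX ta(3) by auto
    have "fpf_involution_on S t" using tS fpf_involution_onD[OF t] SX(1) by (auto simp: fpf_involution_on_def)
    then have "even (card S)" using card_fpf_pairs[of S t] fin SX(1) by (metis dvd_triv_left finite_subset)
    moreover have "p ` S = {p a<..<p (t a)}"
    proof
      show "{p a<..<p (t a)} \<subseteq> p ` S"
      proof
        fix i assume i: "i \<in> {p a<..<p (t a)}"
        then have "i < 2 * m" using p_less[OF ta(1)] by simp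
        then have "flag_at i \<in> S" "p (flag_at i) = i" using flag_at[of i] i by (auto simp: S_def)
        then show "i \<in> p ` S" by (metis imageI)
      qed
    qed (auto simp: S_def)
    then have "card S = p (t a) - p a - 1"
      using card_image[of p S] inj_on_subset[OF inj SX(1)] by simp
    ultimately have par: "even (p a) \<longleftrightarrow> odd (p (t a))" using a(2) by presburger
    have rX: "x \<in> X" "x \<noteq> t a" if "x \<in> reps t" for x
      using that ta(3) a(2) by (auto simp: reps_def[OF t])
    show "\<exists>P. (\<forall>x\<in>reps t - {a}. \<forall>y\<in>reps t - {a}. P x \<longrightarrow> \<not> P y \<longrightarrow> ?l x \<noteq> ?l y \<and> ?r x \<noteq> ?r y) \<and>
       (\<forall>x\<in>reps t - {a}. P x \<longrightarrow> ?r x \<noteq> ?r a) \<and> (\<forall>x\<in>reps t - {a}. \<not> P x \<longrightarrow> ?l x \<noteq> ?l a)"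
    proof (cases "even (p a)")
      case True
      then have odd: "odd (p (t a))" using par by simp
      have sS': "s x \<in> S'" if "x \<in> S'" for x
      proof -
        have x: "x \<in> X" "p a \<le> p x" "p x \<le> p (t a)" using that by (auto simp: S'_def)
        have "p a \<le> p (s x) \<and> p (s x) \<le> p (t a)" unfolding p_s[OF x(1)] by (rule segment_step_bounds(1)[OF True odd x(2,3)])
        then show ?thesis using s_in[OF x(1)] by (simp add: S'_def)
      qed
      have vS: "v x \<in> S" if "x \<in> S" for x
      proof -
        have x: "x \<in> X" "p a < p x" "p x < p (t a)" "p (t a) < 2 * m" using that p_less[OF ta(1)] by (auto simp: S_def)
        have "p a < p (v x) \<and> p (v x) < p (t a)" unfolding p_v[OF x(1)] by (rule arc_step_bounds(1)[OF True odd x(2,3,4)])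
        then show ?thesis using v_in[OF x(1)] by (simp add: S_def)
      qed
      have l: "?l x \<noteq> ?l y" if "x \<in> S'" "y \<in> X" "y \<notin> S'" for x y
        using orbit_class_separated[OF SX(2) sS' tS' that] .
      have r: "?r x \<noteq> ?r y" if "x \<in> S" "y \<in> X" "y \<notin> S" for x y
        using orbit_class_separated[OF SX(1) vS tS that] .
      have mem: "x \<in> S \<longleftrightarrow> x \<in> S'" if "x \<in> reps t - {a}" for x
        using S'eq[of x] SX(3) rX(2)[of x] that by auto
      \<comment> \<open>Inner chords can share with the chord at \<open>a\<close> only its
        \<open>s\<close>-orbit, outer chords only its \<open>v\<close>-orbit.\<close>
      show ?thesis
      proof (intro exI[of _ "\<lambda>x. x \<in> S"] conjI ballI impI)
        fix x y assume "x \<in> reps t - {a}" "y \<in> reps t - {a}" "x \<in> S" "y \<notin> S"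
        then show "?l x \<noteq> ?l y" "?r x \<noteq> ?r y" using l[of x y] r[of x y] mem rX(1) by auto
      next
        fix x assume "x \<in> reps t - {a}" "x \<in> S"
        then show "?r x \<noteq> ?r a" using r[of x a] SX a by simp
      next
        fix x assume "x \<in> reps t - {a}" "x \<notin> S"
        then show "?l x \<noteq> ?l a" using l[of a x, symmetric] SX mem[of x] rX(1)[of x] by simp
      qed
    next
      case False
      then have ev: "even (p (t a))" using par by simp
      have sS: "s x \<in> S" if "x \<in> S" for x
      proof -
        have x: "x \<in> X" "p a < p x" "p x < p (t a)" using that by (auto simp: S_def)
        have "p a < p (s x) \<and> p (s x) < p (t a)" unfolding p_s[OF x(1)] by (rule segment_step_bounds(2)[OF False ev x(2,3)])
        then show ?thesis using s_in[OF x(1)] by (simp add: S_def)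
      qed
      have vS': "v x \<in> S'" if "x \<in> S'" for x
      proof -
        have x: "x \<in> X" "p a \<le> p x" "p x \<le> p (t a)" "p (t a) < 2 * m" using that p_less[OF ta(1)] by (auto simp: S'_def)
        have "p a \<le> p (v x) \<and> p (v x) \<le> p (t a)" unfolding p_v[OF x(1)] by (rule arc_step_bounds(2)[OF False ev x(2,3,4)])
        then show ?thesis using v_in[OF x(1)] by (simp add: S'_def)
      qed
      have l: "?l x \<noteq> ?l y" if "x \<in> S" "y \<in> X" "y \<notin> S" for x y
        using orbit_class_separated[OF SX(1) sS tS that] .
      have r: "?r x \<noteq> ?r y" if "x \<in> S'" "y \<in> X" "y \<notin> S'" for x y
        using orbit_class_separated[OF SX(2) vS' tS' that] .
      have mem: "x \<in> S \<longleftrightarrow> x \<in> S'" if "x \<in> reps t - {a}" for x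
        using S'eq[of x] SX(3) rX(2)[of x] that by auto
      \<comment> \<open>The involutions \<open>s\<close> and \<open>v\<close> have exchanged roles,
        so now the outer chords are those that can meet the \<open>s\<close>-orbit of
        \<open>a\<close>; hence the negated predicate.\<close>
      show ?thesis
      proof (intro exI[of _ "\<lambda>x. x \<notin> S"] conjI ballI impI)
        fix x y assume "x \<in> reps t - {a}" "y \<in> reps t - {a}" "x \<notin> S" "\<not> y \<notin> S"
        then show "?l x \<noteq> ?l y" "?r x \<noteq> ?r y"
          using l[of y x, symmetric] r[of y x, symmetric] mem rX(1) by auto
      next
        fix x assume "x \<in> reps t - {a}" "x \<notin> S"
        then show "?r x \<noteq> ?r a" using r[of a x, symmetric] SX mem[of x] rX(1)[of x] by simp
      next
        fix x assume "x \<in> reps t - {a}" "\<not> x \<notin> S"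
        then show "?l x \<noteq> ?l a" using l[of x a] SX a by simp
      qed
    qed
  qed
  then show ?thesis
    by (simp add: quotient_reps[OF t s_inv] quotient_reps[OF t v_inv] card_reps[OF t])
qed

lemma orbits_eq_iff_noncrossing:
  "card (X // orbit_rel X s t) + card (X // orbit_rel X v t) = m + 1 \<longleftrightarrow> noncrossing p X t"
proof
  assume eq: "card (X // orbit_rel X s t) + card (X // orbit_rel X v t) = m + 1"
  show "noncrossing p X t"
    unfolding noncrossing_def
  proof (intro ballI impI)
    fix a b assume "a \<in> X" "b \<in> X" "b \<noteq> a" "b \<noteq> t a"
    then show "\<not> cross p a (t a) b (t b)"
      using orbits_less[OF t, of a b] eq by auto
  qed
next
  assume "noncrossing p X t"
  then show "card (X // orbit_rel X s t) + card (X // orbit_rel X v t) = m + 1"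
    using noncrossing_bound orbits_le[OF t] by linarith
qed

end

end

text \<open>The witness enumerates the flags as \<open>x, s x, w x, s (w x), w (w x), \<dots>\<close> with \<open>w = v \<circ> s\<close>.\<close>

lemma ex_circle:
  assumes fin: "finite X" and ne: "X \<noteq> {}"
    and s: "fpf_involution_on X s" and v: "fpf_involution_on X v"
    and conn: "\<And>x y. x \<in> X \<Longrightarrow> y \<in> X \<Longrightarrow> (x, y) \<in> orbit_rel X s v"
  shows "\<exists>p m. circle X s v p m"
proof -
  note s' = fpf_involution_onD[OF s] and v' = fpf_involution_onD[OF v]
  define w where "w x = v (s x)" for x
  have wX: "(w ^^ n) x \<in> X" if "x \<in> X" for n x
    using that by (induction n) (simp_all add: w_def s' v')
  have w_inj: "x = y" if "w x = w y" "x \<in> X" "y \<in> X" for x y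
    using that s' v' by (metis w_def)
  have cancel: "(w ^^ d) x = x" if "(w ^^ (i + d)) x = (w ^^ i) x" "x \<in> X" for i d x
    using that(1)
  proof (induction i)
    case (Suc i)
    then have "w ((w ^^ (i + d)) x) = w ((w ^^ i) x)" by simp
    then show ?case using Suc.IH w_inj wX[OF that(2)] by blast
  qed simp
  \<comment> \<open>The walk never reaches the opposite end of its starting segment. Otherwise
    peeling off one step at either end of the walk gives the same situation for \<open>w x\<close>
    and \<open>d - 2\<close>, down to a fixed point of \<open>s\<close> or \<open>v\<close>.\<close>
  have flip: "(w ^^ d) x \<noteq> s x" if "x \<in> X" for d x
    using that
  proof (induction d arbitrary: x rule: less_induct)
    case (less d)
    consider "d = 0" | "d = 1" | d' where "d = Suc (Suc d')" by (metis One_nat_def not0_implies_Suc)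
    then show ?case
    proof cases
      case 1
      then show ?thesis using s'(2)[OF less.prems] by simp
    next
      case 2
      then show ?thesis using s'(1)[OF less.prems] v'(2)[of "s x"] by (simp add: w_def)
    next
      case 3
      have wx: "w x \<in> X" using wX[OF less.prems, of 1] by simp
      have "(w ^^ d) x = w ((w ^^ d') (w x))" unfolding 3 by (simp add: funpow_swap1)
      then have eq: "(w ^^ d) x = v (s ((w ^^ d') (w x)))" by (simp only: w_def[of "(w ^^ d') (w x)"])
      show ?thesis
      proof
        assume "(w ^^ d) x = s x"
        then have "v (v (s ((w ^^ d') (w x)))) = w x" unfolding eq by (simp add: w_def)
        then have "s ((w ^^ d') (w x)) = w x" using v'(3) s'(1) wX[OF wx] by simp
        then have "s (s ((w ^^ d') (w x))) = s (w x)" by simp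
        then have "(w ^^ d') (w x) = s (w x)" using s'(3) wX[OF wx] by simp
        then show False using less.IH[of d' "w x"] wx 3 by simp
      qed
    qed
  qed
  obtain x0 where x0: "x0 \<in> X" using ne by blast
  have "\<not> inj_on (\<lambda>i. (w ^^ i) x0) UNIV"
    using finite_imageD[of "\<lambda>i. (w ^^ i) x0" UNIV] finite_subset[OF _ fin] wX[OF x0] infinite_UNIV_nat
    by (metis image_subsetI)
  then obtain i j where "i < j" "(w ^^ i) x0 = (w ^^ j) x0"
    unfolding inj_on_def by (metis linorder_neqE_nat)
  then have ex: "0 < j - i \<and> (w ^^ (j - i)) x0 = x0" using cancel[of i "j - i" x0] x0 by simp
  define m where "m = (LEAST n. 0 < n \<and> (w ^^ n) x0 = x0)"
  have m: "0 < m" "(w ^^ m) x0 = x0" using LeastI[of "\<lambda>n. 0 < n \<and> (w ^^ n) x0 = x0", OF ex] by (simp_all add: m_def)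
  have mle: "m \<le> n" if "0 < n" "(w ^^ n) x0 = x0" for n
    unfolding m_def using that by (intro Least_le) simp
  have w_ne: "(w ^^ i) x0 \<noteq> (w ^^ j) x0" if "i < j" "j < m" for i j
    using cancel[of i "j - i" x0] mle[of "j - i"] that x0 by auto
  have ws_ne: "(w ^^ i) x0 \<noteq> s ((w ^^ j) x0)" for i j
  proof (cases "j \<le> i")
    case True
    then have "(w ^^ i) x0 = (w ^^ (i - j)) ((w ^^ j) x0)" by (metis comp_apply funpow_add le_add_diff_inverse2)
    then show ?thesis using flip[OF wX[OF x0]] by simp
  next
    case False
    then have "(w ^^ j) x0 = (w ^^ (j - i)) ((w ^^ i) x0)" by (metis comp_apply funpow_add le_add_diff_inverse2 nat_le_linear)
    then show ?thesis using flip[OF wX[OF x0], of "j - i" i] s'(3)[OF wX[OF x0, of j]] by metis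
  qed
  define q where "q k = (if even k then (w ^^ (k div 2)) x0 else s ((w ^^ (k div 2)) x0))" for k
  have qX: "q k \<in> X" for k using wX[OF x0] s'(1) by (simp add: q_def)
  have "q i \<noteq> q j" if "i < j" "j < 2 * m" for i j
  proof -
    have lt: "i div 2 < m" "j div 2 < m" using that by auto
    show ?thesis
    proof (cases "even i \<longleftrightarrow> even j")
      case True
      then have "i div 2 < j div 2" using that by presburger
      then have ne: "(w ^^ (i div 2)) x0 \<noteq> (w ^^ (j div 2)) x0" using w_ne lt by blast
      then have "s ((w ^^ (i div 2)) x0) \<noteq> s ((w ^^ (j div 2)) x0)" using s'(3) wX[OF x0] by metis
      then show ?thesis using ne True by (simp add: q_def)
    next
      case False
      then show ?thesis using ws_ne[of "i div 2" "j div 2"] ws_ne[of "j div 2" "i div 2"]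
        by (auto simp: q_def)
    qed
  qed
  then have q_inj: "inj_on q {..<2 * m}"
    by (intro linorder_inj_onI) auto
  have qs: "s (q k) = q (if even k then k + 1 else k - 1)" for k
    using s'(3)[OF wX[OF x0]] by (auto simp: q_def elim!: oddE)
  have qv: "v (q k) = q (if even k then if k = 0 then 2 * m - 1 else k - 1 else if k = 2 * m - 1 then 0 else k + 1)" for k
  proof -
    have odd: "v (q (2 * i + 1)) = (w ^^ Suc i) x0" for i by (simp add: q_def w_def)
    have vw: "v ((w ^^ Suc i) x0) = q (2 * i + 1)" for i
      using v'(3)[OF qX[of "2 * i + 1"]] odd[of i] by simp
    show ?thesis
    proof (cases "even k")
      case True
      then obtain i where i: "k = 2 * i" by (elim evenE)
      show ?thesis
      proof (cases i)
        case 0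
        obtain n where n: "m = Suc n" using m(1) by (cases m) auto
        \<comment> \<open>Position \<open>0\<close> is read as the return to \<open>x0\<close> after
          \<open>m\<close> steps, which makes the closing arc an ordinary one.\<close>
        have "v (q k) = v ((w ^^ Suc n) x0)" using m(2) i 0 n by (simp add: q_def)
        then show ?thesis using vw[of n] i 0 n by simp
      next
        case (Suc j)
        then show ?thesis using vw[of j] i by (simp add: q_def)
      qed
    next
      case False
      then obtain i where i: "k = 2 * i + 1" by (elim oddE)
      show ?thesis
      proof (cases "k = 2 * m - 1")
        case True
        then have "Suc i = m" using i m(1) by simp
        then show ?thesis using odd[of i] i True m(2) False by (simp add: q_def)
      next
        case ne: False
        then show ?thesis using odd[of i] i by (simp add: q_def)
      qed
    qed
  qed
  have img: "q ` {..<2 * m} = X"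
  proof
    show "X \<subseteq> q ` {..<2 * m}"
    proof
      fix y assume "y \<in> X"
      from conn[OF x0 this] show "y \<in> q ` {..<2 * m}"
      proof (induction rule: orbit_rel_induct)
        case base
        have "q 0 = x0" by (simp add: q_def)
        then show ?case using m(1) by force
      next
        case (step1 z)
        then obtain k where k: "k < 2 * m" "z = q k" by auto
        moreover have "(if even k then k + 1 else k - 1) < 2 * m" using k(1) by (cases "even k"; simp; presburger)
        ultimately show ?case using qs[of k] by (metis image_eqI lessThan_iff)
      next
        case (step2 z)
        then obtain k where k: "k < 2 * m" "z = q k" by auto
        moreover have "(if even k then if k = 0 then 2 * m - 1 else k - 1 else if k = 2 * m - 1 then 0 else k + 1) < 2 * m"
          using k(1) m(1) by auto
        ultimately show ?case using qv[of k] by (metis image_eqI lessThan_iff)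
      qed
    qed
  qed (use qX in auto)
  define p where "p = inv_into {..<2 * m} q"
  have qp: "q (p x) = x" "p x < 2 * m" if "x \<in> X" for x
    using that img f_inv_into_f[of x q "{..<2 * m}"] inv_into_into[of x q "{..<2 * m}"] by (simp_all add: p_def)
  have pq: "p (q k) = k" if "k < 2 * m" for k using that q_inj by (simp add: p_def)
  have "circle X s v p m"
  proof
    show "bij_betw p X {..<2 * m}"
      unfolding p_def using bij_betw_inv_into[of q "{..<2 * m}" X] q_inj img by (simp add: bij_betw_def)
    fix x assume x: "x \<in> X"
    have "(if even (p x) then p x + 1 else p x - 1) < 2 * m" using qp(2)[OF x] by (cases "even (p x)"; simp; presburger)
    from pq[OF this] show "p (s x) = (if even (p x) then p x + 1 else p x - 1)"
      using qs[of "p x"] qp(1)[OF x] by (simp only:)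
    have "(if even (p x) then if p x = 0 then 2 * m - 1 else p x - 1
         else if p x = 2 * m - 1 then 0 else p x + 1) < 2 * m" using qp(2)[OF x] m(1) by auto
    from pq[OF this] show "p (v x) = (if even (p x) then if p x = 0 then 2 * m - 1 else p x - 1
         else if p x = 2 * m - 1 then 0 else p x + 1)"
      using qv[of "p x"] qp(1)[OF x] by (simp only:)
  qed (fact m(1) | erule s'(1) | erule v'(1))+
  then show ?thesis by blast
qed

subsection \<open>Euler genus of partial duals and of sub-ribbon hypermaps\<close>

lemma degree_hmap_eq:
  assumes fin: "finite (hedges H)" "finite (flags H)" and ed: "ed H ` flags H \<subseteq> hedges H"
    and seg: "fpf_involution_on (flags H) (seg H)" "\<And>x. x \<in> flags H \<Longrightarrow> ed H (seg H x) = ed H x"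
  shows "2 * degree_hmap H = card (flags H)"
proof -
  let ?g = "\<lambda>c. the_elem (ed H ` c)"
  have im: "ed H ` {x, seg H x} = {ed H x}" if "x \<in> flags H" for x
    using seg(2)[OF that] by simp
  have g: "ed H ` c = {e} \<longleftrightarrow> ?g c = e" if "c \<in> segments H" for c e
  proof -
    from that obtain x where "x \<in> flags H" "c = {x, seg H x}" by (auto simp: segments_def)
    then have "ed H ` c = {ed H x}" using im by blast
    then show ?thesis by simp
  qed
  have "degree_hmap H = (\<Sum>e\<in>hedges H. \<Sum>c\<in>{c \<in> segments H. ?g c = e}. 1)"
    unfolding degree_hmap_def degree_hedge_def using g by (intro sum.cong) (auto intro!: arg_cong[of _ _ card])
  also have "\<dots> = (\<Sum>c\<in>segments H. 1)"
  proof (rule sum.group)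
    show "finite (segments H)" using fin(2) by (simp add: segments_def)
    show "?g ` segments H \<subseteq> hedges H"
      using ed seg(2) by (auto simp: segments_def)
  qed (use fin in simp)
  also have "\<dots> = card (segments H)" by simp
  finally show ?thesis using card_fpf_pairs[OF fin(2) seg(1)] by (simp add: segments_def)
qed

text \<open>The chain condition puts all discs carrying flags into one component, and a disc without
  flags is a component by itself.\<close>

lemma num_components_eq:
  assumes vx: "vx H ` flags H \<subseteq> hverts H" and ed: "ed H ` flags H \<subseteq> hedges H"
    and fin: "finite (hverts H)" "finite (hedges H)"
    and conn: "\<And>x y. x \<in> flags H \<Longrightarrow> y \<in> flags H \<Longrightarrow>
      (x, y) \<in> {(x, y). x \<in> flags H \<and> y \<in> flags H \<and> (vx H x = vx H y \<or> ed H x = ed H y)}\<^sup>*"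
  shows "num_components H = (if flags H = {} then 0 else 1)
    + card (hverts H - vx H ` flags H) + card (hedges H - ed H ` flags H)"
proof -
  let ?T = "Inl ` vx H ` flags H \<union> Inr ` ed H ` flags H"
  let ?I = "discs H - ?T"
  define E where "E = (\<lambda>x. (Inl (vx H x), Inr (ed H x))) ` flags H \<union> (\<lambda>x. (Inr (ed H x), Inl (vx H x))) ` flags H"
  have same: "same_component H = E\<^sup>* \<inter> discs H \<times> discs H" by (simp add: same_component_def E_def)
  have symE: "sym (E\<^sup>*)" by (rule sym_rtrancl) (auto simp: E_def sym_def)
  have eq: "equiv (discs H) (same_component H)"
    unfolding same using symE
    by (intro equivI) (auto simp: refl_on_def sym_def intro!: transI intro: rtrancl_trans)
  have E1: "(Inl (vx H x), Inr (ed H x)) \<in> E" "(Inr (ed H x), Inl (vx H x)) \<in> E" if "x \<in> flags H" for x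
    using that by (auto simp: E_def)
  have vconn: "(Inl (vx H x), Inl (vx H y)) \<in> E\<^sup>*" if "x \<in> flags H" "y \<in> flags H" for x y
    using conn[OF that]
  proof (induction rule: rtrancl_induct)
    case (step y z)
    then have yz: "y \<in> flags H" "z \<in> flags H" "vx H y = vx H z \<or> ed H y = ed H z" by auto
    have "(Inl (vx H y), Inl (vx H z)) \<in> E\<^sup>*"
    proof (cases "vx H y = vx H z")
      case False
      then have "ed H y = ed H z" using yz(3) by simp
      then show ?thesis using E1(1)[OF yz(1)] E1(2)[OF yz(2)] by (metis converse_rtrancl_into_rtrancl r_into_rtrancl)
    qed simp
    with step.IH show ?case by (rule rtrancl_trans)
  qed simp
  have touched: "(Inl (vx H x), d) \<in> E\<^sup>*" "(d, Inl (vx H x)) \<in> E\<^sup>*" if x: "x \<in> flags H" and "d \<in> ?T" for x d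
  proof -
    show "(Inl (vx H x), d) \<in> E\<^sup>*"
      using \<open>d \<in> ?T\<close>
    proof
      assume "d \<in> Inl ` vx H ` flags H"
      then show ?thesis using vconn[OF x] by auto
    next
      assume "d \<in> Inr ` ed H ` flags H"
      then obtain y where y: "y \<in> flags H" "d = Inr (ed H y)" by auto
      then show ?thesis using vconn[OF x y(1)] E1(1)[OF y(1)] by (simp add: rtrancl_into_rtrancl)
    qed
    then show "(d, Inl (vx H x)) \<in> E\<^sup>*" using symE by (simp add: sym_def)
  qed
  define h where "h d = (if d \<in> ?T then None else Some d)" for d
  have iso: "d' = d" if "(d, d') \<in> E\<^sup>*" "d \<notin> ?T" for d d'
    using that by (induction rule: rtrancl_induct) (auto simp: E_def)
  have "card (discs H // same_component H) = card (h ` discs H)"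
  proof (rule card_quotient_image[OF eq])
    fix d d' assume d: "d \<in> discs H" "d' \<in> discs H"
    have "(d, d') \<in> E\<^sup>* \<longleftrightarrow> h d = h d'"
    proof
      assume *: "(d, d') \<in> E\<^sup>*"
      show "h d = h d'"
      proof (cases "d \<in> ?T \<and> d' \<in> ?T")
        case False
        moreover have "(d', d) \<in> E\<^sup>*" using * symE by (simp add: sym_def)
        ultimately have "d = d'" using * iso by metis
        then show ?thesis by simp
      qed (simp add: h_def)
    next
      assume *: "h d = h d'"
      show "(d, d') \<in> E\<^sup>*"
      proof (cases "d \<in> ?T")
        case True
        then have d': "d' \<in> ?T" using * by (auto simp: h_def split: if_splits)
        from True obtain x where "x \<in> flags H" by auto
        then show ?thesis using touched True d' rtrancl_trans by metis
      qed (use * in \<open>auto simp: h_def split: if_splits\<close>)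
    qed
    then show "(d, d') \<in> same_component H \<longleftrightarrow> h d = h d'" using d by (simp add: same)
  qed
  also have "h ` discs H = (if flags H = {} then {} else {None}) \<union> Some ` ?I"
  proof -
    have "?T \<subseteq> discs H" using vx ed by (auto simp: discs_def)
    then have "discs H = ?T \<union> ?I" by blast
    then have "h ` discs H = h ` ?T \<union> h ` ?I" by (metis image_Un)
    moreover have "h ` ?T = (if flags H = {} then {} else {None})"
      by (auto simp: h_def)
    moreover have "h ` ?I = Some ` ?I" by (rule image_cong) (auto simp: h_def)
    ultimately show ?thesis by simp
  qed
  also have "card \<dots> = (if flags H = {} then 0 else 1) + card ?I"
    using fin by (auto simp: discs_def card_insert_if card_image)
  also have "?I = Inl ` (hverts H - vx H ` flags H) \<union> Inr ` (hedges H - ed H ` flags H)"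
    by (auto simp: discs_def)
  also have "card \<dots> = card (hverts H - vx H ` flags H) + card (hedges H - ed H ` flags H)"
    using fin by (subst card_Un_disjoint) (auto simp: card_image)
  finally show ?thesis by (simp add: num_components_def)
qed

text \<open>A disc without flags counts once as a disc, once as a hyperface and once as a component,
  so it contributes \<open>2 - 1 - 1 = 0\<close>. Only the part carrying flags is left, and it is
  connected.\<close>

lemma euler_genus_eq:
  assumes vx: "vx H ` flags H \<subseteq> hverts H" and ed: "ed H ` flags H \<subseteq> hedges H"
    and fin: "finite (hverts H)" "finite (hedges H)" "finite (flags H)"
    and seg: "fpf_involution_on (flags H) (seg H)" "\<And>x. x \<in> flags H \<Longrightarrow> ed H (seg H x) = ed H x"
    and conn: "\<And>x y. x \<in> flags H \<Longrightarrow> y \<in> flags H \<Longrightarrow>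
      (x, y) \<in> {(x, y). x \<in> flags H \<and> y \<in> flags H \<and> (vx H x = vx H y \<or> ed H x = ed H y)}\<^sup>*"
  shows "euler_genus H = (if flags H = {} then 0 else 2) + int (card (flags H) div 2)
    - int (card (vx H ` flags H)) - int (card (ed H ` flags H))
    - int (card (flags H // orbit_rel (flags H) (varc H) (earc H)))"
proof -
  have "card (hverts H) = card (vx H ` flags H) + card (hverts H - vx H ` flags H)"
    "card (hedges H) = card (ed H ` flags H) + card (hedges H - ed H ` flags H)"
    using vx ed fin by (simp_all add: card_Diff_subset card_mono)
  moreover have "degree_hmap H = card (flags H) div 2"
    using degree_hmap_eq[OF fin(2,3) ed seg] by simp
  ultimately show ?thesis
    using num_components_eq[OF vx ed fin(1,2) conn]
    by (simp add: euler_genus_def euler_char_def num_hfaces_def)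
qed

lemma euler_genus_no_flags:
  assumes "flags H = {}" "finite (hverts H)" "finite (hedges H)"
  shows "euler_genus H = 0"
  using assms by (subst euler_genus_eq) (auto simp: fpf_involution_on_def quotient_def)

section \<open>Hyper-bouquets\<close>

locale bouquet = ribbon_hypermap B for B :: "('v, 'e, 'x) rhmap" +
  assumes one_hvert: "card (hverts B) = 1"
begin

abbreviation "X \<equiv> flags B"
abbreviation "s \<equiv> seg B"
abbreviation "v \<equiv> varc B"
abbreviation "t \<equiv> earc B"

lemmas s_simps = fpf_involution_onD[OF seg_inv]
  and v_simps = fpf_involution_onD[OF varc_inv]
  and t_simps = fpf_involution_onD[OF earc_inv]

lemma ed_s: "x \<in> X \<Longrightarrow> ed B (s x) = ed B x"
  using hedge_circle[of x "s x"] orbit_rel_step(1)[OF orbit_rel_refl] s_simps(1) by metis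

lemma ed_t: "x \<in> X \<Longrightarrow> ed B (t x) = ed B x"
  using hedge_circle[of x "t x"] orbit_rel_step(2)[OF orbit_rel_refl] t_simps(1) by metis

lemma vx_eq:
  assumes "x \<in> X" "y \<in> X"
  shows "vx B x = vx B y"
proof -
  obtain u where "hverts B = {u}" using one_hvert by (auto simp: card_1_singleton_iff)
  then show ?thesis using vx_in assms by simp
qed

lemma flags_connected: "x \<in> X \<Longrightarrow> y \<in> X \<Longrightarrow> (x, y) \<in> orbit_rel X s v"
  using hvert_circle vx_eq by blast

lemma pd_seg_inv: "fpf_involution_on X (pd_seg B A)"
  using s_simps t_simps ed_s ed_t by (auto simp: fpf_involution_on_def pd_seg_def)

lemma pd_earc_eq: "pd_earc B A = pd_seg B (- A)"
  by (auto simp: pd_earc_def pd_seg_def)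

lemma ed_pd_seg: "x \<in> X \<Longrightarrow> ed B (pd_seg B A x) = ed B x"
  by (simp add: pd_seg_def ed_s ed_t)

text \<open>On hyperedges in \<open>A\<close> the orbits are the boundary circles of these
  hyperedges; elsewhere both involutions are \<open>seg\<close>, so each orbit is a single
  segment.\<close>

lemma card_orbits_s_pd_seg:
  "card (X // orbit_rel X s (pd_seg B A)) = card (ed B ` {x \<in> X. ed B x \<in> A}) + card {x \<in> X. ed B x \<notin> A} div 2"
proof -
  let ?g = "pd_seg B A" and ?Y = "{x \<in> X. ed B x \<notin> A}"
  define h :: "'x \<Rightarrow> 'e + 'x set" where "h x = (if ed B x \<in> A then Inl (ed B x) else Inr {x, s x})" for x
  have "card (X // orbit_rel X s ?g) = card (h ` X)"
  proof (rule card_quotient_image[OF equiv_orbit_rel[OF seg_inv pd_seg_inv]])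
    fix x y assume xy: "x \<in> X" "y \<in> X"
    show "(x, y) \<in> orbit_rel X s ?g \<longleftrightarrow> h x = h y"
    proof
      assume "(x, y) \<in> orbit_rel X s ?g"
      then show "h x = h y"
      proof (induction rule: orbit_rel_induct)
        case (step1 z)
        then show ?case using ed_s s_simps(3) by (simp add: h_def insert_commute)
      next
        case (step2 z)
        then show ?case using ed_s ed_t s_simps(3) by (simp add: h_def pd_seg_def insert_commute)
      qed simp
    next
      assume eq: "h x = h y"
      show "(x, y) \<in> orbit_rel X s ?g"
      proof (cases "ed B x \<in> A")
        case True
        then have "ed B x = ed B y" using eq by (simp add: h_def split: if_splits)
        then have "(x, y) \<in> orbit_rel X s t" using hedge_circle xy by blast
        then have "y \<in> X \<and> ed B y = ed B x \<and> (x, y) \<in> orbit_rel X s ?g"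
        proof (induction rule: orbit_rel_induct)
          case base
          then show ?case using xy orbit_rel_refl by simp
        next
          case (step1 z)
          then show ?case using ed_s s_simps(1) orbit_rel_step(1)[of x z X s ?g] by simp
        next
          case (step2 z)
          then have "t z = ?g z" using True by (simp add: pd_seg_def)
          then show ?case using step2 ed_t[of z] t_simps(1)[of z] orbit_rel_step(2)[of x z X s ?g] by simp
        qed
        then show ?thesis by simp
      next
        case False
        then have "y \<in> {x, s x}" using eq by (auto simp: h_def split: if_splits)
        then show ?thesis using xy orbit_rel_refl[OF xy(1)] orbit_rel_step(1)[OF orbit_rel_refl[OF xy(1)], of s ?g] s_simps(1) by auto
      qed
    qed
  qed
  also have "h ` X = Inl ` ed B ` {x \<in> X. ed B x \<in> A} \<union> Inr ` (\<lambda>x. {x, s x}) ` ?Y"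
    by (auto simp: h_def image_iff)
  also have "card \<dots> = card (ed B ` {x \<in> X. ed B x \<in> A}) + card ((\<lambda>x. {x, s x}) ` ?Y)"
    using finite_flags by (subst card_Un_disjoint) (auto simp: card_image)
  also have "fpf_involution_on ?Y s" using s_simps ed_s by (auto simp: fpf_involution_on_def)
  then have "card ((\<lambda>x. {x, s x}) ` ?Y) = card ?Y div 2"
    using card_fpf_pairs[of ?Y s] finite_flags by simp
  finally show ?thesis .
qed

text \<open>This is the Euler genus of the sub-ribbon hypermap \<open>A\<close>, whose hyperfaces correspond to the orbits
  of \<open>v\<close> and \<open>pd_seg B A\<close>.\<close>

definition defect :: "'e set \<Rightarrow> int" where
  "defect A = int (card X div 2) + 1 - int (card (X // orbit_rel X s (pd_seg B A)))
     - int (card (X // orbit_rel X v (pd_seg B A)))"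

text \<open>Up to discs without flags, the hypervertices of the dual are the orbits of
  \<open>v\<close> and \<open>pd_seg B A\<close>, its hyperfaces those of \<open>v\<close> and
  \<open>pd_seg B (- A)\<close>. The orbits of \<open>s\<close> with the two complementary
  involutions together number the hyperedges with flags plus the segments, which turns the sum of
  the defects into Euler's formula for the dual.\<close>

lemma euler_genus_partial_dual:
  assumes "X \<noteq> {}"
  shows "euler_genus (partial_dual B A) = defect A + defect (- A)"
proof -
  let ?D = "partial_dual B A" and ?R = "orbit_rel X (pd_seg B A) v"
  have sel: "flags ?D = X" "vx ?D = (\<lambda>x. Inl (?R `` {x}))" "ed ?D = ed B" "hedges ?D = hedges B"
    "seg ?D = pd_seg B A" "varc ?D = v" "earc ?D = pd_seg B (- A)"
    "hverts ?D = Inl ` (X // ?R) \<union> Inr ` (hverts B - vx B ` X)"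
    by (simp_all add: partial_dual_def Let_def pd_earc_eq)
  have quot: "X // ?R = (\<lambda>x. ?R `` {x}) ` X" by (auto simp: quotient_def)
  have "euler_genus ?D = 2 + int (card X div 2) - int (card (vx ?D ` X)) - int (card (ed B ` X))
    - int (card (X // orbit_rel X v (pd_seg B (- A))))"
  proof (subst euler_genus_eq, unfold sel)
    show "finite (Inl ` (X // ?R) \<union> Inr ` (hverts B - vx B ` X))"
      using finite_hverts finite_flags by (simp add: quot)
    show "(\<lambda>x. Inl (?R `` {x})) ` X \<subseteq> Inl ` (X // ?R) \<union> Inr ` (hverts B - vx B ` X)"
      by (auto simp: quotient_def)
    show "ed B ` X \<subseteq> hedges B" using ed_in by auto
    show "fpf_involution_on X (pd_seg B A)" by (rule pd_seg_inv)
    show "ed B (pd_seg B A x) = ed B x" if "x \<in> X" for x using ed_pd_seg that .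
    fix x y assume xy: "x \<in> X" "y \<in> X"
    define C where "C = {(x, y). x \<in> X \<and> y \<in> X \<and>
      (Inl (?R `` {x}) = (Inl (?R `` {y}) :: 'x set + 'v) \<or> ed B x = ed B y)}"
    from flags_connected[OF xy] have "y \<in> X \<and> (x, y) \<in> C\<^sup>*"
    proof (induction rule: orbit_rel_induct)
      case (step1 z)
      then have "(z, s z) \<in> C" using ed_s s_simps(1) by (simp add: C_def)
      then show ?case using step1 s_simps(1) by (meson rtrancl.rtrancl_into_rtrancl)
    next
      case (step2 z)
      then have z: "z \<in> X" "v z \<in> X" using v_simps(1) by auto
      then have "(z, v z) \<in> ?R" by (intro orbit_rel_step(2) orbit_rel_refl)
      then have "?R `` {z} = ?R `` {v z}"
        using orbit_class_eq_iff[OF pd_seg_inv varc_inv z] by simp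
      then have "(z, v z) \<in> C" using step2 v_simps(1) by (simp add: C_def)
      then show ?case using step2 v_simps(1) by (meson rtrancl.rtrancl_into_rtrancl)
    qed (use xy in simp)
    then show "(x, y) \<in> {(x, y). x \<in> X \<and> y \<in> X \<and>
      (Inl (?R `` {x}) = (Inl (?R `` {y}) :: 'x set + 'v) \<or> ed B x = ed B y)}\<^sup>*"
      by (simp only: C_def)
  qed (use assms finite_hedges finite_flags in simp_all)
  moreover have "card (vx ?D ` X) = card (X // orbit_rel X v (pd_seg B A))"
  proof -
    have "vx ?D ` X = Inl ` (X // ?R)" by (simp add: sel quot image_image)
    then show ?thesis by (simp add: card_image orbit_rel_commute)
  qed
  moreover have "int (card (X // orbit_rel X s (pd_seg B A))) + int (card (X // orbit_rel X s (pd_seg B (- A))))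
    = int (card (ed B ` X)) + int (card X div 2)"
  proof -
    let ?Y = "\<lambda>A. {x \<in> X. ed B x \<in> A}"
    have "ed B ` X = ed B ` ?Y A \<union> ed B ` ?Y (- A)" by auto
    then have 1: "card (ed B ` X) = card (ed B ` ?Y A) + card (ed B ` ?Y (- A))"
      using finite_flags by (simp only:) (rule card_Un_disjoint, auto)
    have 2: "card X = card (?Y A) + card (?Y (- A))"
    proof -
      have "X = ?Y A \<union> ?Y (- A)" by auto
      then show ?thesis using finite_flags card_Un_disjoint[of "?Y A" "?Y (- A)"] by auto
    qed
    have "fpf_involution_on (?Y A) s" "fpf_involution_on (?Y (- A)) s"
      using s_simps ed_s by (auto simp: fpf_involution_on_def)
    moreover have "finite (?Y A)" "finite (?Y (- A))" using finite_flags by simp_all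
    ultimately have "card (?Y A) = 2 * card ((\<lambda>x. {x, s x}) ` ?Y A)"
      "card (?Y (- A)) = 2 * card ((\<lambda>x. {x, s x}) ` ?Y (- A))"
      using card_fpf_pairs by blast+
    then have "even (card (?Y A))" "even (card (?Y (- A)))"
      by presburger+
    then have "card X div 2 = card (?Y A) div 2 + card (?Y (- A)) div 2"
      unfolding 2 by (intro div_plus_div_distrib_dvd_left)
    moreover have compl: "{x \<in> X. ed B x \<notin> A} = ?Y (- A)" "{x \<in> X. ed B x \<notin> - A} = ?Y A" by auto
    ultimately show ?thesis
      using 1 card_orbits_s_pd_seg[of A, unfolded compl] card_orbits_s_pd_seg[of "- A", unfolded compl]
      by linarith
  qed
  ultimately show ?thesis by (simp add: defect_def)
qed

lemma segmentD:
  assumes "c \<in> segments B" "z \<in> c"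
  shows "z \<in> X" "edge_of_segment B c = ed B z"
proof -
  obtain y where y: "y \<in> X" "c = {y, s y}" using assms(1) by (auto simp: segments_def)
  then show "z \<in> X" using assms(2) s_simps(1) by auto
  have "ed B ` c = {ed B y}" "ed B z = ed B y" using y assms(2) ed_s by auto
  then show "edge_of_segment B c = ed B z" by (simp add: edge_of_segment_def)
qed

lemma hverts_the_elem: "x \<in> X \<Longrightarrow> vx B x = the_elem (hverts B)"
  using one_hvert vx_in[of x] by (auto simp: card_1_singleton_iff)

text \<open>Deleting the only hypervertex leaves the central vertices isolated.\<close>

lemma central_connected_iff:
  "central_connected B (the_elem (hverts B)) e f \<longleftrightarrow> e = f \<and> e \<in> hedges B"
proof -
  let ?u = "the_elem (hverts B)"
  have "flags (delete_vertex (ribbon_graph B) (Inl ?u)) = {}"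
  proof -
    have "\<exists>x\<in>X \<times> UNIV. ed (ribbon_graph B) x = c \<and> vx (ribbon_graph B) x = Inl ?u"
      if c: "c \<in> segments B" for c
    proof -
      obtain y where "y \<in> X" "c = {y, s y}" using c by (auto simp: segments_def)
      then show ?thesis using hverts_the_elem
        by (intro bexI[of _ "(y, False)"]) (simp_all add: ribbon_graph_def)
    qed
    then have "{c \<in> hedges (ribbon_graph B). \<forall>x\<in>flags (ribbon_graph B).
        ed (ribbon_graph B) x = c \<longrightarrow> vx (ribbon_graph B) x \<noteq> Inl ?u} = {}"
      by (auto simp: ribbon_graph_def)
    then show ?thesis by (simp add: delete_vertex_def sub_hmap_def)
  qed
  then have "same_component (delete_vertex (ribbon_graph B) (Inl ?u)) =
      Id \<inter> discs (delete_vertex (ribbon_graph B) (Inl ?u)) \<times> discs (delete_vertex (ribbon_graph B) (Inl ?u))"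
    by (simp add: same_component_def)
  moreover have "Inl (Inr e) \<in> discs (delete_vertex (ribbon_graph B) (Inl ?u)) \<longleftrightarrow> e \<in> hedges B"
    by (auto simp: discs_def delete_vertex_def sub_hmap_def ribbon_graph_def)
  ultimately show ?thesis by (auto simp: central_connected_def)
qed

text \<open>Refers to \<open>earc\<close> alone and not to a subset \<open>A\<close>, so that one
  relation decides the defect of every subset.\<close>

definition crossing :: "('x \<Rightarrow> nat) \<Rightarrow> 'x \<Rightarrow> 'x \<Rightarrow> bool" where
  "crossing p a b \<longleftrightarrow> b \<noteq> a \<and> b \<noteq> t a \<and> cross p a (t a) b (t b)"

context
  fixes p :: "'x \<Rightarrow> nat" and m :: nat
  assumes circ: "circle X s v p m"
begin

interpretation circle X s v p m by (rule circ)

lemma p_half_less: "x \<in> X \<Longrightarrow> p x div 2 < m"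
  using p_less[of x] by (simp add: less_mult_imp_div_less mult.commute)

lemma defect_nonneg: "0 \<le> defect A"
  using orbits_le[OF pd_seg_inv, of A] card_X by (simp add: defect_def)

lemma defect_eq_0_iff:
  "defect A = 0 \<longleftrightarrow> (\<forall>a\<in>X. \<forall>b\<in>X. ed B a \<in> A \<longrightarrow> ed B b \<in> A \<longrightarrow> \<not> crossing p a b)"
proof -
  let ?g = "pd_seg B A"
  have "defect A = 0 \<longleftrightarrow> noncrossing p X ?g"
    using orbits_eq_iff_noncrossing[OF pd_seg_inv, of A] card_X by (simp add: defect_def) linarith
  also have "\<dots> \<longleftrightarrow> (\<forall>a\<in>X. \<forall>b\<in>X. ed B a \<in> A \<longrightarrow> ed B b \<in> A \<longrightarrow> \<not> crossing p a b)"
  proof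
    assume nc: "noncrossing p X ?g"
    show "\<forall>a\<in>X. \<forall>b\<in>X. ed B a \<in> A \<longrightarrow> ed B b \<in> A \<longrightarrow> \<not> crossing p a b"
    proof (intro ballI impI notI)
      fix a b assume ab: "a \<in> X" "b \<in> X" "ed B a \<in> A" "ed B b \<in> A" "crossing p a b"
      then have "?g a = t a" "?g b = t b" by (simp_all add: pd_seg_def)
      then show False
        using nc[unfolded noncrossing_def, rule_format, OF ab(1,2)] ab(5) by (simp add: crossing_def)
    qed
  next
    assume *: "\<forall>a\<in>X. \<forall>b\<in>X. ed B a \<in> A \<longrightarrow> ed B b \<in> A \<longrightarrow> \<not> crossing p a b"
    show "noncrossing p X ?g"
      unfolding noncrossing_def
    proof (intro ballI impI)
      fix a b assume a: "a \<in> X" and b: "b \<in> X" and ne: "b \<noteq> a" "b \<noteq> ?g a"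
      note ga = fpf_involution_onD[OF pd_seg_inv a, of A] and gb = fpf_involution_onD[OF pd_seg_inv b, of A]
      have "?g b \<noteq> a" using gb(3) ne(2) by auto
      moreover have "?g b \<noteq> ?g a" using ga(3) gb(3) ne(1) by metis
      ultimately have disj: "{a, ?g a} \<inter> {b, ?g b} = {}" "{b, ?g b} \<inter> {a, ?g a} = {}" using ne by auto
      show "\<not> cross p a (?g a) b (?g b)"
      proof (cases "ed B a \<in> A")
        case False
        then have "?g a = s a" by (simp add: pd_seg_def)
        then show ?thesis using not_cross_s[OF a, of b "?g b"] disj b gb(1) by auto
      next
        case A: True
        then have gta: "?g a = t a" by (simp add: pd_seg_def)
        show ?thesis
        proof (cases "ed B b \<in> A")
          case False
          then have "?g b = s b" by (simp add: pd_seg_def)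
          then have "\<not> cross p b (?g b) a (?g a)" using not_cross_s[OF b, of a "?g a"] disj a ga(1) by auto
          then show ?thesis using cross_commute[of a "?g a" b "?g b"] disj a b ga(1) gb(1) by auto
        next
          case True
          then have "?g b = t b" by (simp add: pd_seg_def)
          then show ?thesis using * a b A True ne gta by (auto simp: crossing_def)
        qed
      qed
    qed
  qed
  finally show ?thesis .
qed

section \<open>Walking around the hypervertex\<close>

lemma vnext_X: "x \<in> X \<Longrightarrow> (vnext B ^^ n) x \<in> X"
  by (induction n) (simp_all add: vnext_def s_simps v_simps)

text \<open>From an even position, crossing the segment raises the position and the arc raises it
  again; the remainder modulo \<open>m\<close> accounts for the closing arc.\<close>

lemma vnext_at_even:
  assumes "h < m"
  shows "(vnext B ^^ n) (flag_at (2 * h)) = flag_at (2 * ((h + n) mod m))"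
proof (induction n)
  case (Suc n)
  define k where "k = (h + n) mod m"
  have k: "k < m" using m_pos by (simp add: k_def)
  have s: "s (flag_at (2 * k)) = flag_at (2 * k + 1)" using flag_at_Suc[of "2 * k"] k by simp
  have "vnext B (flag_at (2 * k)) = flag_at (2 * (Suc k mod m))"
  proof (cases "Suc k = m")
    case True
    have "v (flag_at 0) = flag_at (2 * k + 1)" using v_flag_at_0 True by (auto simp: algebra_simps)
    then have "v (flag_at (2 * k + 1)) = flag_at 0" using v_simps(3)[of "flag_at 0"] flag_at(1)[of 0] m_pos by simp
    then show ?thesis using s True by (simp add: vnext_def)
  next
    case False
    then show ?thesis using flag_at_Suc[of "2 * k + 1"] s k by (simp add: vnext_def)
  qed
  then show ?case using Suc by (simp add: k_def mod_Suc_eq)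
qed (use assms in simp)

text \<open>From an odd position the walk runs backwards. Within one turn it wraps at most once, so
  a case distinction does the work of subtraction modulo \<open>m\<close>.\<close>

lemma vnext_at_odd:
  assumes "h < m" "n \<le> m"
  shows "(vnext B ^^ n) (flag_at (2 * h + 1)) = flag_at (2 * (if n \<le> h then h - n else h + m - n) + 1)"
  using assms(2)
proof (induction n)
  case (Suc n)
  define k where "k = (if n \<le> h then h - n else h + m - n)"
  have k: "k < m" using assms Suc.prems by (auto simp: k_def)
  have fX: "flag_at (2 * k) \<in> X" using flag_at(1) k by simp
  have "s (flag_at (2 * k)) = flag_at (2 * k + 1)" using flag_at_Suc[of "2 * k"] k by simp
  then have "s (flag_at (2 * k + 1)) = flag_at (2 * k)" using s_simps(3)[OF fX] by simp
  then have step: "vnext B (flag_at (2 * k + 1)) = v (flag_at (2 * k))" by (simp add: vnext_def)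
  show ?case
  proof (cases k)
    case 0
    then have "n = h" using assms Suc.prems by (auto simp: k_def split: if_splits)
    moreover have "2 * m - 1 = 2 * (m - 1) + 1" using m_pos by simp
    ultimately show ?thesis using step v_flag_at_0 0 Suc by (auto simp: k_def)
  next
    case (Suc j)
    have "v (flag_at (2 * j + 1)) = flag_at (2 * k)" using flag_at_Suc[of "2 * j + 1"] k Suc by simp
    then have "v (flag_at (2 * k)) = flag_at (2 * j + 1)" using v_simps(3)[of "flag_at (2 * j + 1)"] flag_at(1)[of "2 * j + 1"] k Suc by simp
    moreover have "j = (if Suc n \<le> h then h - Suc n else h + m - Suc n)"
      using Suc k_def assms Suc.prems by (auto split: if_splits)
    ultimately show ?thesis using step Suc.IH Suc.prems by (simp add: k_def)
  qed
qed (use assms in simp)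

text \<open>Every segment is met on the way round, but which of its two flags is reached depends on
  the direction of travel.\<close>

lemma vnext_reaches:
  assumes z: "z \<in> X" and y: "y \<in> X"
  shows "\<exists>n. (vnext B ^^ n) z \<in> {y, s y}"
proof -
  define h h' where "h = p z div 2" and "h' = p y div 2"
  have lt: "h < m" "h' < m" using p_half_less z y by (auto simp: h_def h'_def)
  have y': "flag_at (2 * h') \<in> {y, s y}" "flag_at (2 * h' + 1) \<in> {y, s y}"
  proof -
    have "s (flag_at (2 * h')) = flag_at (2 * h' + 1)" using flag_at_Suc[of "2 * h'"] lt by simp
    moreover have "y = flag_at (2 * h') \<or> y = flag_at (2 * h' + 1)"
      using flag_at_p[OF y] by (cases "even (p y)") (auto simp: h'_def elim!: oddE)
    ultimately show "flag_at (2 * h') \<in> {y, s y}" "flag_at (2 * h' + 1) \<in> {y, s y}"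
      using s_simps(3)[of "flag_at (2 * h')"] flag_at(1)[of "2 * h'"] lt by auto
  qed
  show ?thesis
  proof (cases "even (p z)")
    case True
    then have "z = flag_at (2 * h)" using flag_at_p[OF z] by (simp add: h_def)
    \<comment> \<open>The summand \<open>m\<close> keeps the difference from being truncated and
      vanishes modulo \<open>m\<close>.\<close>
    then have "(vnext B ^^ (h' + m - h)) z = flag_at (2 * h')"
      using vnext_at_even[OF lt(1), of "h' + m - h"] lt by simp
    then show ?thesis using y'(1) by metis
  next
    case False
    define n where "n = (if h' \<le> h then h - h' else h + m - h')"
    have "z = flag_at (2 * h + 1)" using flag_at_p[OF z] False by (simp add: h_def)
    moreover have "n \<le> m" "(if n \<le> h then h - n else h + m - n) = h'" using lt by (auto simp: n_def)
    ultimately have "(vnext B ^^ n) z = flag_at (2 * h' + 1)"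
      using vnext_at_odd[OF lt(1), of n] by simp
    then show ?thesis using y'(2) by metis
  qed
qed

text \<open>\<open>h z\<close> below is the first flag of \<open>e\<close> met from \<open>z\<close>.  It changes only within its orbit when \<open>z\<close>
  moves along an orbit of \<open>v\<close> and \<open>pd_seg B {e}\<close>, so these orbits restrict to the hyperfaces of the
  sub-ribbon hypermap \<open>e\<close>.\<close>

lemma euler_genus_sub_hmap:
  assumes Yne: "y0 \<in> X" "ed B y0 = e"
  shows "euler_genus (sub_hmap B {e}) = defect {e}"
proof -
  let ?H = "sub_hmap B {e}" and ?g = "pd_seg B {e}" and ?w = "vnext B"
  define Y where "Y = {x \<in> X. ed B x \<in> {e}}"
  define N where "N z = (LEAST n. ed B ((?w ^^ n) z) \<in> {e})" for z
  define h where "h z = (?w ^^ N z) z" for z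
  define v' where "v' = varc ?H"
  have v'_eq: "v' z = h (v z)" for z by (simp add: v'_def sub_hmap_def h_def N_def)
  have YX: "x \<in> X" if "x \<in> Y" for x using that by (simp add: Y_def)
  have sY: "s x \<in> Y \<longleftrightarrow> x \<in> Y" if "x \<in> X" for x using that ed_s s_simps(1) by (simp add: Y_def)
  have tY: "t x \<in> Y" if "x \<in> Y" for x using that ed_t t_simps(1) by (simp add: Y_def)
  have g: "x \<in> Y \<Longrightarrow> ?g x = t x" "x \<in> X \<Longrightarrow> x \<notin> Y \<Longrightarrow> ?g x = s x" for x
    by (simp_all add: Y_def pd_seg_def)
  have wX: "?w z \<in> X" if "z \<in> X" for z using vnext_X[OF that, of 1] by simp
  have ex: "\<exists>n. ed B ((?w ^^ n) z) \<in> {e}" if z: "z \<in> X" for z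
  proof -
    obtain n where "(?w ^^ n) z \<in> {y0, s y0}" using vnext_reaches[OF z Yne(1)] by blast
    then show ?thesis using Yne ed_s by (intro exI[of _ n]) auto
  qed
  have hY: "h z \<in> Y" if "z \<in> X" for z
    using LeastI_ex[OF ex[OF that]] vnext_X[OF that] by (simp add: Y_def h_def N_def)
  have before: "(?w ^^ n) z \<notin> Y" if "n < N z" for n z
    using not_less_Least[of n "\<lambda>n. ed B ((?w ^^ n) z) \<in> {e}"] that by (simp add: Y_def N_def)
  have h_Y: "h z = z" if "z \<in> Y" for z
  proof -
    have "N z = 0" unfolding N_def using that by (intro Least_equality) (simp_all add: Y_def)
    then show ?thesis by (simp add: h_def)
  qed
  have h_w: "h (?w z) = h z" if z: "z \<in> X" "z \<notin> Y" for z
  proof -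
    obtain n where "ed B ((?w ^^ n) z) \<in> {e}" using ex[OF z(1)] by blast
    moreover have "\<not> ed B ((?w ^^ 0) z) \<in> {e}" using z by (simp add: Y_def)
    ultimately have "N z = Suc (LEAST n. ed B ((?w ^^ Suc n) z) \<in> {e})" unfolding N_def by (rule Least_Suc)
    also have "\<dots> = Suc (N (?w z))" by (simp add: N_def funpow_swap1)
    finally show ?thesis by (simp add: h_def funpow_swap1)
  qed
  \<comment> \<open>Reversal of the walk: after \<open>n\<close> steps over deleted segments, taking
    the last arc back and resuming the search finds the same flag as searching from
    \<open>s z\<close> in the opposite direction.\<close>
  have turn: "h (v ((?w ^^ n) z)) = h (s z)"
    if "z \<in> X" "0 < n" "\<And>k. k < n \<Longrightarrow> (?w ^^ k) z \<notin> Y" for n z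
    using that
  proof (induction n arbitrary: z)
    case (Suc n)
    show ?case
    proof (cases "n = 0")
      case True
      then show ?thesis using v_simps(3)[OF s_simps(1)[OF Suc.prems(1)]] by (simp add: vnext_def)
    next
      case False
      have wz: "?w z \<in> X" "?w z \<notin> Y" using wX[OF Suc.prems(1)] Suc.prems(3)[of 1] False by simp_all
      have "h (v ((?w ^^ n) (?w z))) = h (s (?w z))"
      proof (rule Suc.IH[OF wz(1)])
        fix k assume "k < n"
        then show "(?w ^^ k) (?w z) \<notin> Y" using Suc.prems(3)[of "Suc k"] by (simp add: funpow_swap1)
      qed (use False in simp)
      also have "\<dots> = h (?w (s (?w z)))" using h_w[of "s (?w z)"] s_simps(1)[OF wz(1)] sY[OF wz(1)] wz(2) by simp
      also have "?w (s (?w z)) = v (?w z)" using s_simps(3)[OF wz(1)] by (simp add: vnext_def)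
      also have "\<dots> = s z" using v_simps(3)[OF s_simps(1)[OF Suc.prems(1)]] by (simp add: vnext_def)
      finally show ?thesis by (simp add: funpow_swap1)
    qed
  qed simp
  \<comment> \<open>A deleted segment lies on an arc of the sub-ribbon hypermap, and
    \<open>h z\<close> and \<open>h (s z)\<close> are the ends of this arc.\<close>
  have v'_h: "v' (h z) = h (s z)" if "z \<in> X" "z \<notin> Y" for z
  proof -
    have "N z \<noteq> 0"
    proof
      assume "N z = 0"
      then have "h z = z" by (simp add: h_def)
      then show False using hY[OF that(1)] that(2) by simp
    qed
    then show ?thesis using turn[OF that(1), of "N z"] before by (simp add: v'_eq h_def)
  qed
  have h_v: "h (v z) = v' (h z)" if z: "z \<in> X" for z
  proof (cases "z \<in> Y")
    case False
    then have "h (s z) = h (?w (s z))" using h_w[of "s z"] s_simps(1)[OF z] sY[OF z] by simp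
    also have "?w (s z) = v z" using s_simps(3)[OF z] by (simp add: vnext_def)
    finally show ?thesis using v'_h[OF z False] by simp
  qed (simp add: v'_eq h_Y)
  let ?R = "orbit_rel X v ?g" and ?R' = "orbit_rel Y v' t"
  have eqR: "equiv X ?R" by (rule equiv_orbit_rel[OF varc_inv pd_seg_inv])
  \<comment> \<open>A step over a deleted segment applies \<open>s\<close>, which agrees with
    \<open>?g\<close> there, and then \<open>v\<close>, so it stays in the orbit.\<close>
  have R_w: "(z, (?w ^^ n) z) \<in> ?R" if z: "z \<in> X" and "n \<le> N z" for z n
    using that(2)
  proof (induction n)
    case 0
    then show ?case using z by (simp add: orbit_rel_refl)
  next
    case (Suc n)
    define y where "y = (?w ^^ n) z"
    have y: "y \<in> X" "y \<notin> Y" "(z, y) \<in> ?R"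
      using vnext_X[OF z] before[of n z] Suc by (simp_all add: y_def)
    then have "(z, s y) \<in> ?R" using orbit_rel_step(2)[of z y X v ?g] g(2)[OF y(1,2)] s_simps(1)[OF y(1)] by simp
    then have "(z, v (s y)) \<in> ?R" using v_simps(1)[OF s_simps(1)[OF y(1)]] by (rule orbit_rel_step(1))
    then show ?case by (simp add: y_def vnext_def[of B "(vnext B ^^ n) z"])
  qed
  have R_h: "(z, h z) \<in> ?R" if "z \<in> X" for z using R_w[OF that, of "N z"] by (simp add: h_def)
  have RR': "(x, y) \<in> ?R' \<longleftrightarrow> (x, y) \<in> ?R" if xy: "x \<in> Y" "y \<in> Y" for x y
  proof
    assume "(x, y) \<in> ?R'"
    then have "y \<in> Y \<and> (x, y) \<in> ?R"
    proof (induction rule: orbit_rel_induct)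
      case base
      then show ?case using xy(1) orbit_rel_refl[OF YX[OF xy(1)]] by simp
    next
      case (step1 z)
      then have z: "z \<in> X" "(x, z) \<in> ?R" using YX by simp_all
      have vz: "v z \<in> X" using v_simps(1)[OF z(1)] .
      have "(x, v z) \<in> ?R" using z(2) vz by (rule orbit_rel_step(1))
      then have "(x, h (v z)) \<in> ?R" using R_h[OF vz] by (rule orbit_rel_trans)
      then show ?case using hY[OF vz] by (simp add: v'_eq)
    next
      case (step2 z)
      then have z: "z \<in> Y" "(x, z) \<in> ?R" by simp_all
      have "(x, ?g z) \<in> ?R" using z(2) by (rule orbit_rel_step(2)) (use YX tY z(1) g(1) in simp)
      then show ?case using g(1) tY z(1) by simp
    qed
    then show "(x, y) \<in> ?R" by simp
  next
    assume "(x, y) \<in> ?R"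
    then have "y \<in> X \<and> (x, h y) \<in> ?R'"
    proof (induction rule: orbit_rel_induct)
      case base
      then show ?case using xy(1) YX h_Y orbit_rel_refl[of x Y v' t] by simp
    next
      case (step1 z)
      then have z: "v z \<in> X" "(x, h z) \<in> ?R'" using v_simps(1) by simp_all
      have "v' (h z) \<in> Y" using h_v hY[OF z(1)] step1 by simp
      with z(2) have "(x, v' (h z)) \<in> ?R'" by (rule orbit_rel_step(1))
      then show ?case using h_v z step1 by simp
    next
      case (step2 z)
      then have z: "z \<in> X" "?g z \<in> X" "(x, h z) \<in> ?R'"
        using fpf_involution_onD(1)[OF pd_seg_inv] by simp_all
      show ?case
      proof (cases "z \<in> Y")
        case True
        then have "t (h z) \<in> Y" using h_Y tY by simp
        with z(3) have "(x, t (h z)) \<in> ?R'" by (rule orbit_rel_step(2))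
        then show ?thesis using z(2) g(1)[OF True] h_Y tY True by simp
      next
        case False
        have eq: "h (?g z) = v' (h z)" using g(2) v'_h False z(1) by simp
        have "v' (h z) \<in> Y" using eq hY[OF z(2)] by simp
        with z(3) have "(x, v' (h z)) \<in> ?R'" by (rule orbit_rel_step(1))
        then show ?thesis using eq z(2) by simp
      qed
    qed
    then show "(x, y) \<in> ?R'" using h_Y xy(2) by simp
  qed
  \<comment> \<open>Symmetry is inherited from \<open>?R\<close>, without recourse to
    \<open>v'\<close> being an involution.\<close>
  have eqR': "equiv Y ?R'"
  proof (rule equivI)
    show "?R' \<subseteq> Y \<times> Y" by (auto simp: orbit_rel_def)
    show "refl_on Y ?R'" by (auto simp: refl_on_def orbit_rel_def)
    show "trans ?R'" by (rule transI) (rule orbit_rel_trans)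
    show "sym ?R'"
    proof (rule symI)
      fix x y assume xy: "(x, y) \<in> ?R'"
      then have "x \<in> Y" "y \<in> Y" by (auto simp: orbit_rel_def)
      moreover from this have "(y, x) \<in> ?R" using RR' xy eqR by (meson equivE symE)
      ultimately show "(y, x) \<in> ?R'" using RR' by simp
    qed
  qed
  have "card (Y // ?R') = card ((\<lambda>x. ?R `` {x}) ` Y)"
  proof (rule card_quotient_image[OF eqR'])
    fix x y assume "x \<in> Y" "y \<in> Y"
    then show "(x, y) \<in> ?R' \<longleftrightarrow> ?R `` {x} = ?R `` {y}"
      using RR' YX eq_equiv_class_iff[OF eqR] by simp
  qed
  also have "(\<lambda>x. ?R `` {x}) ` Y = X // ?R"
  proof
    show "X // ?R \<subseteq> (\<lambda>x. ?R `` {x}) ` Y"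
    proof
      fix c assume "c \<in> X // ?R"
      then obtain x where x: "x \<in> X" "c = ?R `` {x}" by (meson quotientE)
      then have "c = ?R `` {h x}" using equiv_class_eq[OF eqR R_h] by simp
      then show "c \<in> (\<lambda>x. ?R `` {x}) ` Y" using hY[OF x(1)] by blast
    qed
  qed (use YX in \<open>auto simp: quotient_def\<close>)
  finally have faces: "card (Y // ?R') = card (X // ?R)" .
  have sel: "flags ?H = Y" "vx ?H = vx B" "ed ?H = ed B" "seg ?H = s" "earc ?H = t" "varc ?H = v'"
    "hverts ?H = hverts B" "hedges ?H = hedges B \<inter> {e}"
    by (simp_all add: sub_hmap_def Y_def v'_def)
  have y0: "y0 \<in> Y" using Yne by (simp add: Y_def)
  have fpf: "fpf_involution_on Y s" using s_simps sY YX by (auto simp: fpf_involution_on_def)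
  have "euler_genus ?H = 2 + int (card Y div 2) - int (card (vx B ` Y)) - int (card (ed B ` Y)) - int (card (Y // ?R'))"
  proof (subst euler_genus_eq, unfold sel)
    show "vx B ` Y \<subseteq> hverts B" using vx_in YX by auto
    show "ed B ` Y \<subseteq> hedges B \<inter> {e}" using ed_in by (auto simp: Y_def)
    show "finite (hverts B)" "finite (hedges B \<inter> {e})" "finite Y"
      using finite_hverts finite_flags by (auto simp: Y_def)
    show "fpf_involution_on Y s" by (rule fpf)
    show "ed B (s x) = ed B x" if "x \<in> Y" for x using ed_s YX[OF that] .
    show "(x, y) \<in> {(x, y). x \<in> Y \<and> y \<in> Y \<and> (vx B x = vx B y \<or> ed B x = ed B y)}\<^sup>*"
      if "x \<in> Y" "y \<in> Y" for x y
      using that vx_eq YX by (intro r_into_rtrancl) simp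
  qed (use y0 in auto)
  moreover have "vx B ` Y = {vx B y0}" using y0 vx_eq YX by auto
  moreover have "ed B ` Y = {e}" using y0 Yne by (auto simp: Y_def)
  moreover have "card X = card Y + card (X - Y)"
    using finite_flags YX by (metis card_Diff_subset card_mono finite_subset le_add_diff_inverse subsetI)
  moreover have "even (card Y)"
    using card_fpf_pairs[OF _ fpf] finite_flags YX by (metis dvd_triv_left finite_subset subsetI)
  moreover have "X - Y = {x \<in> X. ed B x \<notin> {e}}" by (auto simp: Y_def)
  \<comment> \<open>The deleted segments are orbits of \<open>s\<close> and \<open>?g\<close> of
    their own; they cancel against the excess of \<open>card X div 2\<close> over
    \<open>card Y div 2\<close>.\<close>
  moreover have "card X div 2 = card Y div 2 + card (X - Y) div 2"
    using \<open>card X = card Y + card (X - Y)\<close> \<open>even (card Y)\<close> by (simp add: div_plus_div_distrib_dvd_left)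
  ultimately show ?thesis
    using card_orbits_s_pd_seg[of "{e}"] faces by (simp add: defect_def Y_def)
qed

subsection \<open>The intersection graph\<close>

text \<open>Segments never cross anything, so by additivity of \<open>cross\<close> the chords along the boundaries of
  two hyperedges cannot all avoid each other while other pairs of their flags cross.\<close>

lemma ex_crossing:
  assumes x: "x \<in> X" "ed B x = e" "x' \<in> X" "ed B x' = e" and y: "y \<in> X" "ed B y = f" "y' \<in> X" "ed B y' = f"
    and "e \<noteq> f" and cr: "cross p x x' y y'"
  shows "\<exists>a\<in>X. \<exists>b\<in>X. ed B a = e \<and> ed B b = f \<and> crossing p a b"
proof (rule ccontr)
  assume none: "\<not> ?thesis"
  have no: "\<not> cross p a (t a) b (t b)" if "a \<in> X" "b \<in> X" "ed B a = e" "ed B b = f" for a b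
  proof
    assume "cross p a (t a) b (t b)"
    moreover have "b \<noteq> a" "b \<noteq> t a" using that \<open>e \<noteq> f\<close> ed_t[of a] by auto
    ultimately have "crossing p a b" by (simp add: crossing_def)
    then show False using none that by blast
  qed
  \<comment> \<open>The walk along the boundary of \<open>e\<close> keeps a chord of
    \<open>f\<close> fixed; the walk along the boundary of \<open>f\<close> afterwards keeps
    \<open>x\<close> and \<open>x'\<close> fixed.\<close>
  have e_chord: "\<not> cross p x z b (t b)" if b: "b \<in> X" "ed B b = f" and z: "z \<in> X" "ed B z = e" for b z
  proof -
    have "(x, z) \<in> orbit_rel X s t" using hedge_circle[of x z] x z by simp
    then have "z \<in> X \<and> ed B z = e \<and> \<not> cross p x z b (t b)"
    proof (induction rule: orbit_rel_induct)
      case base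
      then show ?case using x by (simp add: cross_def)
    next
      case (step1 z)
      then have z: "z \<in> X" "ed B z = e" "\<not> cross p x z b (t b)" by simp_all
      have "{z, s z} \<inter> {b, t b} = {}" using z b \<open>e \<noteq> f\<close> ed_s[of z] ed_t[of b] by auto
      then have "\<not> cross p z (s z) b (t b)" using not_cross_s[of z b "t b"] z b t_simps(1) by simp
      then show ?case using z s_simps(1) ed_s cross_add_left[of p x "s z" b "t b" z] by simp
    next
      case (step2 z)
      then have z: "z \<in> X" "ed B z = e" "\<not> cross p x z b (t b)" by simp_all
      then show ?case using no[OF z(1) b(1) z(2) b(2)] t_simps(1) ed_t
          cross_add_left[of p x "t z" b "t b" z] by simp
    qed
    then show ?thesis by simp
  qed
  have "(y, y') \<in> orbit_rel X s t" using hedge_circle[of y y'] y by simp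
  then have "y' \<in> X \<and> ed B y' = f \<and> \<not> cross p x x' y y'"
  proof (induction rule: orbit_rel_induct)
    case base
    then show ?case using y by (simp add: cross_def)
  next
    case (step1 z)
    then have z: "z \<in> X" "ed B z = f" "\<not> cross p x x' y z" by simp_all
    have disj: "{z, s z} \<inter> {x, x'} = {}" "{x, x'} \<inter> {z, s z} = {}"
      using z x \<open>e \<noteq> f\<close> ed_s[of z] by auto
    then have "\<not> cross p z (s z) x x'" using not_cross_s[of z x x'] z x by simp
    then have "\<not> cross p x x' z (s z)" using cross_commute[of x x' z "s z"] disj z x s_simps(1) by simp
    then show ?case using z s_simps(1) ed_s cross_add_right[of p x x' y "s z" z] by simp
  next
    case (step2 z)
    then have z: "z \<in> X" "ed B z = f" "\<not> cross p x x' y z" by simp_all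
    then show ?case using e_chord[OF z(1,2) x(3,4)] t_simps(1) ed_t
        cross_add_right[of p x x' y "t z" z] by simp
  qed
  then show False using cr by simp
qed

text \<open>Within one turn the positions are monotone apart from at most one passage of the closing
  arc, so of four flags met in succession the first and third separate the other two.\<close>

lemma cross_vnext:
  assumes x: "x \<in> X" and ijk: "0 < i" "i < j" "j < k" and ret: "\<And>n. n \<in> {1..k} \<Longrightarrow> (vnext B ^^ n) x \<noteq> x"
  shows "cross p x ((vnext B ^^ j) x) ((vnext B ^^ i) x) ((vnext B ^^ k) x)"
proof -
  define h where "h = p x div 2"
  have h: "h < m" using p_half_less[OF x] by (simp add: h_def)
  show ?thesis
  proof (cases "even (p x)")
    case True
    then have px: "p x = 2 * h" "flag_at (2 * h) = x" using flag_at_p[OF x] by (simp_all add: h_def)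
    note vn = vnext_at_even[OF h, unfolded px(2)]
    \<comment> \<open>After \<open>m\<close> steps the walk is back at \<open>x\<close>, so the
      absence of returns up to \<open>k\<close> forces \<open>k < m\<close>.\<close>
    have "(vnext B ^^ m) x = x" using vn[of m] h px(2) by simp
    then have km: "k < m" using ret[of m] m_pos by (cases "k < m") auto
    have "p ((vnext B ^^ n) x) = 2 * (if h + n < m then h + n else h + n - m)" if "n < m" for n
      using vn[of n] flag_at(2)[of "2 * ((h + n) mod m)"] m_pos that h by (simp add: mod_if)
    then show ?thesis using ijk km px(1) h
      by (cases "h + i < m"; cases "h + j < m"; cases "h + k < m"; auto simp: cross_def)
  next
    case False
    then have px: "p x = 2 * h + 1" "flag_at (2 * h + 1) = x" using flag_at_p[OF x] by (simp_all add: h_def)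
    note vn = vnext_at_odd[OF h, unfolded px(2)]
    have "(vnext B ^^ m) x = x" using vn[of m] h px(2) by simp
    then have km: "k < m" using ret[of m] m_pos by (cases "k < m") auto
    have "p ((vnext B ^^ n) x) = 2 * (if n \<le> h then h - n else h + m - n) + 1" if "n < m" for n
    proof -
      have "2 * (if n \<le> h then h - n else h + m - n) + 1 < 2 * m" using that h by auto
      then show ?thesis using vn[of n] flag_at(2) that by simp
    qed
    then show ?thesis using ijk km px(1) h
      by (cases "i \<le> h"; cases "j \<le> h"; cases "k \<le> h"; auto simp: cross_def)
  qed
qed

lemma half_eqD:
  assumes "x \<in> X" "y \<in> X" "p x div 2 = p y div 2"
  shows "y \<in> {x, s x}"
proof -
  have "p y = p x \<or> p y = p (s x)"
    unfolding p_s[OF assms(1)] using assms(3) by (cases "even (p x)"; simp; presburger)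
  then show ?thesis using p_eq assms(1,2) s_simps(1) by auto
qed

lemma flag_at_half: "x \<in> X \<Longrightarrow> flag_at (2 * (p x div 2)) \<in> {x, s x}"
  using half_eqD[of x "flag_at (2 * (p x div 2))"] flag_at[of "2 * (p x div 2)"] p_half_less[of x] by simp

text \<open>The walk starts at the even flag of the first segment, from where it runs in increasing
  order. The last alternative of the hypothesis covers a fourth segment reached only after the
  closing arc; \<open>?k\<close> then gains the summand \<open>m\<close>.\<close>

lemma in_cyclic_order_segments:
  assumes X: "x1 \<in> X" "x2 \<in> X" "x3 \<in> X" "x4 \<in> X"
    and lt: "p x1 div 2 < p x2 div 2" "p x2 div 2 < p x3 div 2"
      "p x3 div 2 < p x4 div 2 \<or> p x4 div 2 < p x1 div 2"
  shows "in_cyclic_order B (the_elem (hverts B)) {x1, s x1} {x2, s x2} {x3, s x3} {x4, s x4}"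
proof -
  define h where "h z = p z div 2" for z
  have hm: "h z < m" if "z \<in> X" for z using p_half_less[OF that] by (simp add: h_def)
  have hs: "flag_at (2 * h z) \<in> {z, s z}" if "z \<in> X" for z using flag_at_half[OF that] by (simp add: h_def)
  let ?x = "flag_at (2 * h x1)"
  let ?k = "if h x1 < h x4 then h x4 - h x1 else h x4 + m - h x1"
  note lt' = lt[folded h_def]
  note vn = vnext_at_even[OF hm[OF X(1)]]
  have xX: "?x \<in> X" "p ?x = 2 * h x1" using flag_at hm[OF X(1)] by simp_all
  have segs: "{{x1, s x1}, {x2, s x2}, {x3, s x3}, {x4, s x4}} \<subseteq> segments B"
    using X by (auto simp: segments_def)
  have vx: "vx B ?x = the_elem (hverts B)" using hverts_the_elem xX(1) by simp
  have lts: "0 < h x2 - h x1" "h x2 - h x1 < h x3 - h x1" "h x3 - h x1 < ?k"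
    using lt' hm[OF X(3)] by auto
  have ret: "(vnext B ^^ n) ?x \<noteq> ?x" if "n \<in> {1..?k}" for n
  proof
    assume "(vnext B ^^ n) ?x = ?x"
    then have "p (flag_at (2 * ((h x1 + n) mod m))) = 2 * h x1" using vn[of n] xX(2) by simp
    then have "(h x1 + n) mod m = h x1" using flag_at(2)[of "2 * ((h x1 + n) mod m)"] m_pos by simp
    moreover have "0 < n" "n < m" using that hm[OF X(1)] hm[OF X(4)] lt' by (auto split: if_splits)
    ultimately show False using hm[OF X(1)] by (auto simp: mod_if split: if_splits)
  qed
  have mem: "(vnext B ^^ (h x2 - h x1)) ?x \<in> {x2, s x2}" "(vnext B ^^ (h x3 - h x1)) ?x \<in> {x3, s x3}"
    using hs X lt' hm vn by simp_all
  have mem4: "(vnext B ^^ ?k) ?x \<in> {x4, s x4}"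
  proof -
    have "(h x1 + ?k) mod m = h x4" using lt' hm[OF X(1)] hm[OF X(4)] by auto
    then show ?thesis using vn[of ?k] hs[OF X(4)] by simp
  qed
  show ?thesis
    unfolding in_cyclic_order_def
  proof (intro conjI bexI exI ballI)
    show "?x \<in> {x1, s x1}" by (rule hs[OF X(1)])
  qed (fact segs vx lts mem mem4 | erule ret)+
qed

text \<open>Alternating segments give crossing pairs of flags, which \<open>ex_crossing\<close>
  converts into crossing chords; conversely the segments at the ends of two crossing chords
  alternate. Central vertices being isolated, the condition on components only says that the
  hyperedges differ.\<close>

lemma intersection_adj_iff:
  "intersection_adj B e f \<longleftrightarrow> e \<noteq> f \<and> (\<exists>a\<in>X. \<exists>b\<in>X. ed B a = e \<and> ed B b = f \<and> crossing p a b)"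
proof
  let ?u = "the_elem (hverts B)"
  assume "intersection_adj B e f"
  then obtain c1 c2 c3 c4 where alt: "alternate B ?u c1 c2 c3 c4"
    and es: "edge_of_segment B c1 = e" "edge_of_segment B c2 = f" "edge_of_segment B c3 = e" "edge_of_segment B c4 = f"
    by (auto simp: intersection_adj_def)
  then have cyc: "in_cyclic_order B ?u c1 c2 c3 c4" and nc: "\<not> central_connected B ?u e f"
    and ee: "central_connected B ?u e e"
    by (simp_all add: alternate_def Let_def)
  then have ef: "e \<noteq> f" by auto
  from cyc have cs: "c1 \<in> segments B" "c2 \<in> segments B" "c3 \<in> segments B" "c4 \<in> segments B"
    by (simp_all add: in_cyclic_order_def)
  from cyc obtain x i j k where x: "x \<in> c1" and ijk: "0 < i" "i < j" "j < k"
    and ret: "\<forall>n\<in>{1..k}. (vnext B ^^ n) x \<noteq> x"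
    and mem: "(vnext B ^^ i) x \<in> c2" "(vnext B ^^ j) x \<in> c3" "(vnext B ^^ k) x \<in> c4"
    unfolding in_cyclic_order_def by (elim conjE bexE exE) (rule that)
  have cr: "cross p x ((vnext B ^^ j) x) ((vnext B ^^ i) x) ((vnext B ^^ k) x)"
    using cross_vnext[OF segmentD(1)[OF cs(1) x] ijk] ret by blast
  have "\<exists>a\<in>X. \<exists>b\<in>X. ed B a = e \<and> ed B b = f \<and> crossing p a b"
    using segmentD[OF cs(1) x] segmentD[OF cs(2) mem(1)] segmentD[OF cs(3) mem(2)] segmentD[OF cs(4) mem(3)] es
    by (intro ex_crossing[OF _ _ _ _ _ _ _ _ ef cr]) simp_all
  then show "e \<noteq> f \<and> (\<exists>a\<in>X. \<exists>b\<in>X. ed B a = e \<and> ed B b = f \<and> crossing p a b)"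
    using ef by simp
next
  let ?u = "the_elem (hverts B)"
  assume "e \<noteq> f \<and> (\<exists>a\<in>X. \<exists>b\<in>X. ed B a = e \<and> ed B b = f \<and> crossing p a b)"
  then obtain a b where ef: "e \<noteq> f" and a: "a \<in> X" "ed B a = e" and b: "b \<in> X" "ed B b = f"
    and cr: "crossing p a b" by blast
  have ta: "t a \<in> X" "ed B (t a) = e" and tb: "t b \<in> X" "ed B (t b) = f"
    using a b t_simps(1) ed_t by simp_all
  have adj: "intersection_adj B e f"
    if "in_cyclic_order B ?u {x1, s x1} {x2, s x2} {x3, s x3} {x4, s x4}"
      "x1 \<in> X" "ed B x1 = e" "x2 \<in> X" "ed B x2 = f" "x3 \<in> X" "ed B x3 = e" "x4 \<in> X" "ed B x4 = f"
    for x1 x2 x3 x4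
  proof -
    have seg: "edge_of_segment B {z, s z} = ed B z" if "z \<in> X" for z
      using segmentD(2)[of "{z, s z}" z] that by (simp add: segments_def)
    have "e \<in> hedges B" "f \<in> hedges B" using ed_in that by blast+
    then have "alternate B ?u {x1, s x1} {x2, s x2} {x3, s x3} {x4, s x4}"
      using that seg ef by (simp add: alternate_def Let_def central_connected_iff)
    then show ?thesis unfolding intersection_adj_def
      by (intro exI conjI) (assumption | simp add: seg that)+
  qed
  define h where "h z = p z div 2" for z
  have hne: "h x \<noteq> h y" if "x \<in> X" "ed B x = e" "y \<in> X" "ed B y = f" for x y
    using half_eqD[OF that(1,3)] that ef ed_s by (auto simp: h_def)
  \<comment> \<open>A chord along a segment crosses nothing, so the ends of a crossed chord lie on
    different segments and have different indices \<open>h\<close>.\<close>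
  have "t a \<noteq> s a"
  proof
    assume eq: "t a = s a"
    have "{a, s a} \<inter> {b, t b} = {}" using a b tb ef ed_s[OF a(1)] by auto
    then show False using not_cross_s[OF a(1), of b "t b"] cr b tb eq by (simp add: crossing_def)
  qed
  then have hta: "h a \<noteq> h (t a)" using half_eqD[OF a(1) ta(1)] t_simps(2)[OF a(1)] by (auto simp: h_def)
  have order: "p x < p y \<longleftrightarrow> h x < h y" if "h x \<noteq> h y" for x y
    using that unfolding h_def by linarith
  note ne = hne[OF a b] hne[OF a tb] hne[OF ta b] hne[OF ta tb]
  have cross: "((h a < h b) \<noteq> (h a < h (t b))) \<noteq> ((h (t a) < h b) \<noteq> (h (t a) < h (t b)))"
    using cr ne by (simp add: crossing_def cross_def order)
  define goal where "goal x1 x2 x3 x4 \<longleftrightarrow> h x1 < h x2 \<and> h x2 < h x3 \<and> (h x3 < h x4 \<or> h x4 < h x1)" for x1 x2 x3 x4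
  \<comment> \<open>The first segment is the earlier one of the two at the ends of the
    \<open>e\<close>-chord; the second is the one segment of the \<open>f\<close>-chord lying
    between them.\<close>
  have "goal a b (t a) (t b) \<or> goal a (t b) (t a) b \<or> goal (t a) b a (t b) \<or> goal (t a) (t b) a b"
    using cross ne[unfolded linorder_neq_iff] hta[unfolded linorder_neq_iff] unfolding goal_def by auto
  moreover have "intersection_adj B e f" if "goal x1 x2 x3 x4"
      "x1 \<in> X" "ed B x1 = e" "x2 \<in> X" "ed B x2 = f" "x3 \<in> X" "ed B x3 = e" "x4 \<in> X" "ed B x4 = f" for x1 x2 x3 x4
    using that adj[OF in_cyclic_order_segments[of x1 x2 x3 x4]] by (simp add: goal_def h_def)
  ultimately show "intersection_adj B e f" using a b ta tb by (elim disjE) simp_all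
qed

end

text \<open>The coefficient counts subsets, so nothing can cancel. The bound is an inequality
  because \<open>nat\<close> sends every non-positive genus to the exponent
  \<open>0\<close>.\<close>

lemma coeff_partial_dual_poly_ne_0:
  "coeff (partial_dual_poly B) 0 \<noteq> 0 \<longleftrightarrow> (\<exists>A\<subseteq>hedges B. euler_genus (partial_dual B A) \<le> 0)"
proof -
  have "coeff (partial_dual_poly B) 0 = (\<Sum>A\<in>Pow (hedges B). if euler_genus (partial_dual B A) \<le> 0 then 1 else 0)"
    unfolding partial_dual_poly_def coeff_sum by (intro sum.cong) (auto simp: coeff_monom)
  also have "\<dots> = int (card {A \<in> Pow (hedges B). euler_genus (partial_dual B A) \<le> 0})"
    using finite_hedges by (simp add: sum.If_cases Int_def)
  finally show ?thesis using finite_hedges by (auto simp: card_eq_0_iff)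
qed

lemma coeff_ne_0_no_flags:
  assumes "X = {}"
  shows "coeff (partial_dual_poly B) 0 \<noteq> 0" "\<not> intersection_adj B e f" "euler_genus (sub_hmap B A) = 0"
proof -
  have "euler_genus (partial_dual B {}) = 0"
    using assms finite_hedges finite_hverts
    by (intro euler_genus_no_flags) (auto simp: partial_dual_def Let_def quotient_def)
  then show "coeff (partial_dual_poly B) 0 \<noteq> 0" unfolding coeff_partial_dual_poly_ne_0 by (intro exI[of _ "{}"]) simp
  show "\<not> intersection_adj B e f"
    using assms by (auto simp: intersection_adj_def alternate_def in_cyclic_order_def segments_def)
  show "euler_genus (sub_hmap B A) = 0"
    using assms finite_hedges finite_hverts by (intro euler_genus_no_flags) (auto simp: sub_hmap_def)
qed

text \<open>A suitable \<open>A\<close> is one colour class: it must separate any two crossing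
  chords. Chords of the same hyperedge can never be separated, which is where the genus condition on
  single hyperedges comes from.\<close>

lemma coeff_ne_0_iff:
  assumes ne: "X \<noteq> {}"
  shows "coeff (partial_dual_poly B) 0 \<noteq> 0 \<longleftrightarrow> bipartite_graph (hedges B) (intersection_adj B) \<and>
    (\<forall>e\<in>hedges B. euler_genus (sub_hmap B {e}) = 0)"
proof -
  obtain p m where circ: "circle X s v p m"
    using ex_circle[OF finite_flags ne seg_inv varc_inv flags_connected] by blast
  note adj = intersection_adj_iff[OF circ]
  have genus: "euler_genus (partial_dual B A) \<le> 0 \<longleftrightarrow> (\<forall>a\<in>X. \<forall>b\<in>X. crossing p a b \<longrightarrow>
      \<not> (ed B a \<in> A \<longleftrightarrow> ed B b \<in> A))" for A
  proof -
    have "euler_genus (partial_dual B A) \<le> 0 \<longleftrightarrow> defect A = 0 \<and> defect (- A) = 0"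
      using euler_genus_partial_dual[OF ne, of A] defect_nonneg[OF circ, of A] defect_nonneg[OF circ, of "- A"] by linarith
    then show ?thesis by (auto simp: defect_eq_0_iff[OF circ])
  qed
  have sub: "euler_genus (sub_hmap B {e}) = 0 \<longleftrightarrow> (\<forall>a\<in>X. \<forall>b\<in>X. ed B a = e \<longrightarrow> ed B b = e \<longrightarrow> \<not> crossing p a b)" for e
  proof (cases "\<exists>y\<in>X. ed B y = e")
    case True
    then show ?thesis using euler_genus_sub_hmap[OF circ] defect_eq_0_iff[OF circ, of "{e}"] by auto
  next
    case False
    then have "euler_genus (sub_hmap B {e}) = 0"
      using finite_hedges finite_hverts by (intro euler_genus_no_flags) (auto simp: sub_hmap_def)
    then show ?thesis using False by blast
  qed
  show ?thesis
  proof
    assume "coeff (partial_dual_poly B) 0 \<noteq> 0"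
    then obtain A where A: "A \<subseteq> hedges B" "\<forall>a\<in>X. \<forall>b\<in>X. crossing p a b \<longrightarrow> \<not> (ed B a \<in> A \<longleftrightarrow> ed B b \<in> A)"
      unfolding coeff_partial_dual_poly_ne_0 genus by blast
    have "bipartite_graph (hedges B) (intersection_adj B)"
      unfolding bipartite_graph_def
      by (rule exI[of _ A], rule exI[of _ "hedges B - A"]) (use A in \<open>auto simp: adj\<close>)
    moreover have "\<forall>e\<in>hedges B. euler_genus (sub_hmap B {e}) = 0"
      unfolding sub using A(2) by (intro ballI impI notI) metis
    ultimately show "bipartite_graph (hedges B) (intersection_adj B) \<and>
      (\<forall>e\<in>hedges B. euler_genus (sub_hmap B {e}) = 0)" by blast
  next
    assume *: "bipartite_graph (hedges B) (intersection_adj B) \<and> (\<forall>e\<in>hedges B. euler_genus (sub_hmap B {e}) = 0)"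
    then obtain A Y where A: "A \<union> Y = hedges B" "A \<inter> Y = {}"
      and bip: "\<And>e f. e \<in> hedges B \<Longrightarrow> f \<in> hedges B \<Longrightarrow> intersection_adj B e f \<Longrightarrow>
        e \<in> A \<and> f \<in> Y \<or> e \<in> Y \<and> f \<in> A"
      unfolding bipartite_graph_def by blast
    have "\<not> (ed B a \<in> A \<longleftrightarrow> ed B b \<in> A)" if ab: "a \<in> X" "b \<in> X" "crossing p a b" for a b
    proof -
      have h: "ed B a \<in> hedges B" "ed B b \<in> hedges B" using ab ed_in by simp_all
      have "ed B a \<noteq> ed B b" using * h(1) ab unfolding sub by metis
      then have "intersection_adj B (ed B a) (ed B b)" unfolding adj using ab by blast
      then show ?thesis using bip[OF h] A(2) by blast
    qed
    moreover have "A \<subseteq> hedges B" using A(1) by blast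
    ultimately show "coeff (partial_dual_poly B) 0 \<noteq> 0"
      unfolding coeff_partial_dual_poly_ne_0 genus by (intro exI[of _ A] conjI ballI impI)
  qed
qed

end

theorem theorem4p7:
  fixes B :: "('v, 'e, 'x) rhmap"
  assumes "hyper_bouquet B"
  shows "coeff (partial_dual_poly B) 0 \<noteq> 0 \<longleftrightarrow>
    bipartite_graph (hedges B) (intersection_adj B) \<and>
    (\<forall>e\<in>hedges B. euler_genus (sub_hmap B {e}) = 0)"
proof -
  interpret bouquet B
    using assms by (simp add: hyper_bouquet_def bouquet_def bouquet_axioms_def)
  show ?thesis
  proof (cases "X = {}")
    case True
    have "bipartite_graph (hedges B) (intersection_adj B)"
      unfolding bipartite_graph_def using coeff_ne_0_no_flags(2)[OF True]
      by (intro exI[of _ "hedges B"] exI[of _ "{}"]) simp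
    then show ?thesis using coeff_ne_0_no_flags(1,3)[OF True] by simp
  qed (rule coeff_ne_0_iff)
qed

end
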